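(* Let $\mathcal S$ and $\mathcal T$ be two IFSs on Euclidean spaces satisfying the strong separation condition. Then $\mathcal S\simeq\mathcal T$ if and only if $\mathcal S^G\simeq\mathcal T^G$ for all multiplicative sub-semigroups $G$ of $(0,1)$.
   Context: Two metric spaces are Lipschitz equivalent if there is a bijection $f$ between them and $L\ge 1$ with $L^{-1}d_1(x,y)\le d_2(f(x),f(y))\le L\,d_1(x,y)$ for all $x,y$. An IFS is a finite family $\mathcal S=\{S_1,\dots,S_n\}$ of contracting similarities of a Euclidean space $\mathbb R^d$ ($d$ may depend on the IFS), where $S_i$ has ratio $r_i\in(0,1)$, i.e. $|S_i(x)-S_i(y)|=r_i|x-y|$. The two given IFSs $\mathcal S,\mathcal T$ contain at least two maps each. $E_{\mathcal S}$ is the unique nonempty compact set with $E_{\mathcal S}=\bigcup_i S_i(E_{\mathcal S})$. $\mathcal S$ satisfies the strong separation condition (SSC) if the sets $S_i(E_{\mathcal S})$ are pairwise disjoint. $\operatorname{sgp}\mathcal S$ is the multiplicative sub-semigroup of the positive reals generated by the ratios $r_1,\dots,r_n$. For a multiplicative sub-semigroup $G$ of $(0,1)$ (a subset closed under multiplication), $\mathcal S^G=\{S\in\mathcal S: (r\cdot\operatorname{sgp}\mathcal S)\cap G\ne\emptyset,\text{ where } r \text{ is the ratio of } S\}$, a (possibly empty) subfamily of $\mathcal S$; $\mathcal T^G$ is defined likewise using $\operatorname{sgp}\mathcal T$. Notation: $\mathcal S\simeq\mathcal T$ means that $E_{\mathcal S}$ and $E_{\mathcal T}$ are Lipschitz equivalent,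 with the conventions that $\mathcal S\simeq\emptyset$ if and only if $\mathcal S=\emptyset$, and that $\mathcal S\simeq\{S\}$ (a one-element family) if and only if $\mathcal S$ also contains exactly one similarity. *)

theory Defs
  imports "HOL-Analysis.Analysis"
begin

definition Lipschitz_equivalent :: "'a::metric_space set \<Rightarrow> 'b::metric_space set \<Rightarrow> bool" where
  "Lipschitz_equivalent X Y \<longleftrightarrow>
     (\<exists>f L. bij_betw f X Y \<and> L \<ge> 1 \<and>
        (\<forall>x\<in>X. \<forall>y\<in>X. inverse L * dist x y \<le> dist (f x) (f y) \<and>
                       dist (f x) (f y) \<le> L * dist x y))"

definition similarity_with_ratio :: "real \<Rightarrow> ('a::euclidean_space \<Rightarrow> 'a) \<Rightarrow> bool" where
  "similarity_with_ratio r f \<longleftrightarrow> (\<forall>x y. dist (f x) (f y) = r * dist x y)"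

(* The ratio is unique because a type of class euclidean_space has two distinct points. *)
definition ratio :: "('a::euclidean_space \<Rightarrow> 'a) \<Rightarrow> real" where
  "ratio f = (THE r. similarity_with_ratio r f)"

definition contracting_similarity :: "('a::euclidean_space \<Rightarrow> 'a) \<Rightarrow> bool" where
  "contracting_similarity f \<longleftrightarrow> (\<exists>r. 0 < r \<and> r < 1 \<and> similarity_with_ratio r f)"

(* Families are sets of maps.  Nothing is lost compared with indexed families: strong
   separation forbids repeated maps.  The empty family is allowed, since the subfamilies
   considered below may be empty. *)
definition IFS :: "('a::euclidean_space \<Rightarrow> 'a) set \<Rightarrow> bool" where
  "IFS S \<longleftrightarrow> finite S \<and> (\<forall>f\<in>S. contracting_similarity f)"

(* Well defined for every nonempty IFS (Hutchinson); unspecified for the empty family. *)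
definition attractor :: "('a::euclidean_space \<Rightarrow> 'a) set \<Rightarrow> 'a set" where
  "attractor S = (THE E. E \<noteq> {} \<and> compact E \<and> E = (\<Union>f\<in>S. f ` E))"

definition strong_separation :: "('a::euclidean_space \<Rightarrow> 'a) set \<Rightarrow> bool" where
  "strong_separation S \<longleftrightarrow> disjoint_family_on (\<lambda>f. f ` attractor S) S"

inductive_set generated_semigroup :: "real set \<Rightarrow> real set" for R where
  generator: "r \<in> R \<Longrightarrow> r \<in> generated_semigroup R"
| mult: "a \<in> generated_semigroup R \<Longrightarrow> b \<in> generated_semigroup R
           \<Longrightarrow> a * b \<in> generated_semigroup R"

definition sgp :: "('a::euclidean_space \<Rightarrow> 'a) set \<Rightarrow> real set" where
  "sgp S = generated_semigroup (ratio ` S)"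

definition subsemigroup_unit_interval :: "real set \<Rightarrow> bool" where
  "subsemigroup_unit_interval G \<longleftrightarrow> G \<subseteq> {0<..<1} \<and> (\<forall>a\<in>G. \<forall>b\<in>G. a * b \<in> G)"

definition restrict_IFS :: "('a::euclidean_space \<Rightarrow> 'a) set \<Rightarrow> real set \<Rightarrow> ('a \<Rightarrow> 'a) set" where
  "restrict_IFS S G = {f \<in> S. (\<lambda>a. ratio f * a) ` sgp S \<inter> G \<noteq> {}}"

(* An empty family is equivalent only to an empty family, and a one-element family only to
   a one-element family; otherwise equivalence means Lipschitz equivalence of the attractors. *)
definition IFS_equiv ::
    "('a::euclidean_space \<Rightarrow> 'a) set \<Rightarrow> ('b::euclidean_space \<Rightarrow> 'b) set \<Rightarrow> bool"
    (infix "\<simeq>" 50) where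
  "S \<simeq> T \<longleftrightarrow>
     (if S = {} \<or> T = {} then S = {} \<and> T = {}
      else if is_singleton S \<or> is_singleton T then is_singleton S \<and> is_singleton T
      else Lipschitz_equivalent (attractor S) (attractor T))"

end

(* A dust-like attractor is bilipschitz to the space of streams over its maps, the distance of two streams being
   the product of the ratios along their common prefix; so let f be a bilipschitz bijection of two such spaces, over
   alphabets A and B, and write A' and B' for the letters surviving in S^G and T^G.

   For a word I let J(I) be the longest common prefix of the f-image of the cylinder of I; its weight is comparable to
   that of I. Below a suitable word f multiplies the natural measure by a constant (Falconer and Marsh), so the ratios
   weight J(I) / weight I take finitely many values there. Since a product of ratios lying in G uses only surviving
   letters, a pigeonhole argument on these values yields a word I such that f maps the A'-streams below I to B'-streams
   below J(I).

   This image need not be open. By symmetry the dimension of A' is at least that of B', so counting cylinders shows that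
   the image comes arbitrarily close, relative to scale, to filling a cylinder of B'-streams. A limit of rescaled
   copies of the inverse of f is then a bilipschitz embedding of the B'-streams onto a clopen subset of the A'-streams,
   and every nonempty clopen subset of the A'-streams is bilipschitz to all of them. *)
theory Submission
  imports Defs "HOL-Library.Stream"
begin

section \<open>Words, weights and the symbolic metric\<close>

text \<open>The semigroup enters through two facts only, collected in \<open>saturated\<close>: a
  word over the surviving letters can be completed to one with weight in G, and a word with weight
  in G consists of surviving letters. The obstacle is that f knows nothing of G. The link is the
  ratio weight J(I) / weight I: when it returns to an earlier value, the source word and the target
  word added in between have equal weight, so membership in G passes from source to target. This
  works in one direction only. Streams over A' go to streams over B', but other A-streams may go
  there as well, and the embeddings obtained from f and from its inverse live below unrelated words,
  so they do not fit together to a bijection. Counting yields words all of whose extensions of a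
  prescribed length are hit, with nothing said about longer extensions; this is why a limit is
  taken. The image stays open in the limit because the blow-ups share the constant L * L, one factor
  from f and one from normalising source and target weights, so that the radius of openness is the
  same for all of them.\<close>

lemma stake_in_lists: "x \<in> streams A \<Longrightarrow> stake n x \<in> lists A"
  by (induct n arbitrary: x) (auto elim: streamsE)

lemma sdrop_in_streams: "x \<in> streams A \<Longrightarrow> sdrop n x \<in> streams A"
  by (simp add: streams_iff_snth sdrop_snth)

lemma shift_in_streams_iff: "w @- x \<in> streams A \<longleftrightarrow> w \<in> lists A \<and> x \<in> streams A"
  by (induct w) (auto simp: streams_Stream)

lemma stake_eq_iff: "stake n x = stake n y \<longleftrightarrow> (\<forall>i<n. x !! i = y !! i)"
  by (induct n) (auto simp: stake_Suc less_Suc_eq simp del: stake.simps(2))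

lemma stake_eq_mono: "stake n x = stake n y \<Longrightarrow> m \<le> n \<Longrightarrow> stake m x = stake m y"
  by (auto simp: stake_eq_iff)

lemma stream_eq_iff: "x = y \<longleftrightarrow> (\<forall>n. stake n x = stake n y)"
proof
  assume "\<forall>n. stake n x = stake n y"
  then have "x !! i = y !! i" for i
    unfolding stake_eq_iff by blast
  then have "smap id x = y"
    by (subst smap_alt) simp
  then show "x = y" by (simp add: stream.map_id)
qed simp

lemma stream_split:
  assumes "x \<noteq> y"
  obtains n where "stake n x = stake n y" "x !! n \<noteq> y !! n"
proof -
  define n where "n = (LEAST n. x !! n \<noteq> y !! n)"
  from assms have "\<exists>n. x !! n \<noteq> y !! n"
    unfolding stream_eq_iff stake_eq_iff by blast
  then have "x !! n \<noteq> y !! n" unfolding n_def by (rule LeastI_ex)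
  moreover have "stake n x = stake n y"
    unfolding stake_eq_iff n_def using not_less_Least by blast
  ultimately show ?thesis using that by blast
qed

lemma stake_length_shift [simp]: "stake (length w) (w @- x) = w"
  by (simp add: stake_shift)

lemma sdrop_length_shift [simp]: "sdrop (length w) (w @- x) = x"
  by (simp add: sdrop_shift)

lemma stake_length_eqD: "stake (length w) x = w \<Longrightarrow> x = w @- sdrop (length w) x"
  by (metis stake_sdrop)

lemma stake_le_append: "m \<le> n \<Longrightarrow> stake n x = stake m x @ stake (n - m) (sdrop m x)"
  by simp

lemma finite_words: "finite A \<Longrightarrow> finite {w \<in> lists A. length w = n}"
  using finite_lists_length_eq[of A n] by (simp add: lists_eq_set)

lemma finite_words_le: "finite A \<Longrightarrow> finite {w \<in> lists A. length w \<le> n}"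
  using finite_lists_length_le[of A n] by (simp add: lists_eq_set)

section \<open>Weights of words and the prefix distance\<close>

definition weight :: "('a \<Rightarrow> real) \<Rightarrow> 'a list \<Rightarrow> real" where
  "weight r w = prod_list (map r w)"

lemma weight_simps [simp]:
  "weight r [] = 1" "weight r (i # w) = r i * weight r w" "weight r (v @ w) = weight r v * weight r w"
  by (simp_all add: weight_def)

lemma weight_powr: "(\<And>i. i \<in> A \<Longrightarrow> 0 < r i) \<Longrightarrow> w \<in> lists A \<Longrightarrow> weight (\<lambda>i. r i powr s) w = weight r w powr s \<and> 0 < weight r w"
  by (induct w) (auto simp: powr_mult)

definition sdist :: "('a \<Rightarrow> real) \<Rightarrow> 'a stream \<Rightarrow> 'a stream \<Rightarrow> real" where
  "sdist r x y = (if x = y then 0 else weight r (stake (LEAST n. x !! n \<noteq> y !! n) x))"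

lemma sdist_self [simp]: "sdist r x x = 0"
  by (simp add: sdist_def)

lemma sdist_eqI:
  assumes "stake n x = stake n y" "x !! n \<noteq> y !! n"
  shows "sdist r x y = weight r (stake n x)"
proof -
  have "(LEAST n. x !! n \<noteq> y !! n) = n"
    using assms by (intro Least_equality) (auto simp: stake_eq_iff not_less[symmetric])
  moreover have "x \<noteq> y" using assms by auto
  ultimately show ?thesis by (simp add: sdist_def)
qed

lemma sdist_sym: "sdist r x y = sdist r y x"
proof (cases "x = y")
  case False
  then obtain n where "stake n x = stake n y" "x !! n \<noteq> y !! n" by (rule stream_split)
  then show ?thesis using sdist_eqI[of n x y] sdist_eqI[of n y x] by auto
qed simp

lemma sdist_shift [simp]: "sdist r (w @- x) (w @- y) = weight r w * sdist r x y"
proof (cases "x = y")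
  case False
  then obtain n where n: "stake n x = stake n y" "x !! n \<noteq> y !! n" by (rule stream_split)
  have "sdist r (w @- x) (w @- y) = weight r (stake (length w + n) (w @- x))"
    by (rule sdist_eqI) (use n in \<open>auto simp: stake_shift\<close>)
  then show ?thesis using sdist_eqI[OF n] by (simp add: stake_shift)
qed simp

text \<open>Both distances are read off the prefix before the first difference, which lies within
  the first k letters. Through this, bilipschitz bounds pass to a limit map exactly, without any
  epsilon.\<close>

lemma sdist_cong:
  assumes "stake k x = stake k x'" "stake k y = stake k y'" "stake k x \<noteq> stake k y"
  shows "sdist r x y = sdist r x' y'"
proof -
  from assms(3) have "x \<noteq> y" by auto
  then obtain n where n: "stake n x = stake n y" "x !! n \<noteq> y !! n" by (rule stream_split)
  have "n < k"
    using n(1) assms(3) stake_eq_mono by (metis not_less)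
  then have "stake n x' = stake n x" "stake n y' = stake n y" "x' !! n = x !! n" "y' !! n = y !! n"
    using assms(1,2) stake_eq_mono[of k x x' n] stake_eq_mono[of k y y' n]
    by (auto simp: stake_eq_iff)
  with n show ?thesis using sdist_eqI[of n x y r] sdist_eqI[of n x' y' r] by simp
qed

locale alphabet =
  fixes A :: "'a set" and r :: "'a \<Rightarrow> real"
  assumes finite_alphabet: "finite A"
    and ratio_pos: "i \<in> A \<Longrightarrow> 0 < r i"
    and ratio_less_1: "i \<in> A \<Longrightarrow> r i < 1"
begin

text \<open>The inserted 1/2 keeps \<open>Min\<close> and \<open>Max\<close> meaningful for an empty
  alphabet and leaves both bounds strictly between 0 and 1.\<close>

definition rmin :: real where "rmin = Min (insert (1/2) (r ` A))"

definition rmax :: real where "rmax = Max (insert (1/2) (r ` A))"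

lemma rmin_pos: "0 < rmin" and rmin_less_1: "rmin < 1" and rmax_pos: "0 < rmax" and rmax_less_1: "rmax < 1"
  and rmin_le: "i \<in> A \<Longrightarrow> rmin \<le> r i" and le_rmax: "i \<in> A \<Longrightarrow> r i \<le> rmax"
  using finite_alphabet ratio_pos ratio_less_1
  by (auto simp: rmin_def rmax_def Min_le_iff Max_ge_iff Min_gr_iff Max_less_iff Min_less_iff Max_gr_iff)

lemma weight_pos: "w \<in> lists A \<Longrightarrow> 0 < weight r w"
  by (induct w) (auto simp: ratio_pos)

lemma weight_le_pow: "w \<in> lists A \<Longrightarrow> weight r w \<le> rmax ^ length w"
proof (induct w)
  case (Cons i w)
  then have "r i * weight r w \<le> rmax * rmax ^ length w"
    using weight_pos[of w] by (intro mult_mono) (auto simp: le_rmax less_imp_le[OF rmax_pos])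
  then show ?case by simp
qed simp

lemma weight_ge_pow: "w \<in> lists A \<Longrightarrow> rmin ^ length w \<le> weight r w"
  by (induct w) (auto intro!: mult_mono simp: rmin_le less_imp_le rmin_pos ratio_pos)

lemma weight_le_1: "w \<in> lists A \<Longrightarrow> weight r w \<le> 1"
  using weight_le_pow[of w] power_le_one[of rmax "length w"] rmax_pos rmax_less_1 by simp

lemma weight_less_1: "w \<in> lists A \<Longrightarrow> w \<noteq> [] \<Longrightarrow> weight r w < 1"
  using weight_le_pow[of w] power_Suc_less_one[of rmax "length w - 1"] rmax_pos rmax_less_1 by simp

lemma rmax_pow_small: "0 < e \<Longrightarrow> \<exists>n. rmax ^ n < e"
  using real_arch_pow_inv[of e rmax] rmax_less_1 by blast

lemma rmax_pow_mono: "m \<le> n \<Longrightarrow> rmax ^ n \<le> rmax ^ m"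
  using power_decreasing[of m n rmax] rmax_pos rmax_less_1 by simp

lemma weight_stake_pos: "x \<in> streams A \<Longrightarrow> 0 < weight r (stake n x)"
  by (rule weight_pos[OF stake_in_lists])

lemma weight_stake_mono: "x \<in> streams A \<Longrightarrow> m \<le> n \<Longrightarrow> weight r (stake n x) \<le> weight r (stake m x)"
  using arg_cong[OF stake_le_append[of m n x], of "weight r"] weight_le_1[OF stake_in_lists[OF sdrop_in_streams], of x "n - m" m]
    weight_stake_pos[of x m]
  by (simp only: weight_simps mult_left_le less_imp_le)

lemma weight_stake_less: "x \<in> streams A \<Longrightarrow> m < n \<Longrightarrow> weight r (stake n x) < weight r (stake m x)"
  using arg_cong[OF stake_le_append[of m n x], of "weight r"] weight_less_1[OF stake_in_lists[OF sdrop_in_streams], of x "n - m" m]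
    weight_stake_pos[of x m]
  by (cases "n - m") (simp_all del: stake_add stake.simps)

lemma sdist_nonneg: "x \<in> streams A \<Longrightarrow> 0 \<le> sdist r x y"
  by (auto simp: sdist_def weight_stake_pos less_imp_le)

lemma sdist_pos: "x \<in> streams A \<Longrightarrow> x \<noteq> y \<Longrightarrow> 0 < sdist r x y"
  by (auto simp: sdist_def weight_stake_pos)

lemma sdist_le:
  assumes "x \<in> streams A" "stake n x = stake n y"
  shows "sdist r x y \<le> weight r (stake n x)"
proof (cases "x = y")
  case True then show ?thesis using assms weight_stake_pos[of x n] by simp
next
  case False
  then obtain m where m: "stake m x = stake m y" "x !! m \<noteq> y !! m" by (rule stream_split)
  then have "n \<le> m" using assms(2) unfolding stake_eq_iff by (meson not_less)
  then show ?thesis using sdist_eqI[OF m, of r] weight_stake_mono[OF assms(1)] by simp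
qed

lemma sdist_le_1: "x \<in> streams A \<Longrightarrow> sdist r x y \<le> 1"
  using sdist_le[of x 0 y] by simp

lemma sdist_le_pow: "x \<in> streams A \<Longrightarrow> stake n x = stake n y \<Longrightarrow> sdist r x y \<le> rmax ^ n"
  using sdist_le[of x n y] weight_le_pow[OF stake_in_lists, of x n] by simp

text \<open>Every further letter strictly shrinks the weight. Mostly used in contrapositive form: a
  distance of at most the weight of a prefix forces agreement on that prefix.\<close>

lemma sdist_greater:
  assumes "x \<in> streams A" "stake n x \<noteq> stake n y"
  shows "weight r (stake n x) < sdist r x y"
proof -
  have "x \<noteq> y" using assms(2) by auto
  then obtain m where m: "stake m x = stake m y" "x !! m \<noteq> y !! m" by (rule stream_split)
  then have "m < n" using assms(2) stake_eq_mono[OF m(1)] by (meson not_less)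
  then show ?thesis using sdist_eqI[OF m, of r] weight_stake_less[OF assms(1)] by simp
qed

lemma sdist_ge_pow: "x \<in> streams A \<Longrightarrow> stake n x \<noteq> stake n y \<Longrightarrow> rmin ^ n \<le> sdist r x y"
  using sdist_greater[of x n y] weight_ge_pow[OF stake_in_lists, of x n] by simp

end

section \<open>Bilipschitz equivalence for arbitrary distance functions\<close>

definition bilip_equiv :: "'a set \<Rightarrow> ('a \<Rightarrow> 'a \<Rightarrow> real) \<Rightarrow> 'b set \<Rightarrow> ('b \<Rightarrow> 'b \<Rightarrow> real) \<Rightarrow> bool" where
  "bilip_equiv X d Y e \<longleftrightarrow> (\<exists>f L. bij_betw f X Y \<and> L \<ge> 1 \<and>
     (\<forall>x\<in>X. \<forall>y\<in>X. d x y \<le> L * e (f x) (f y) \<and> e (f x) (f y) \<le> L * d x y))"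

lemma bilip_equivI:
  assumes "bij_betw f X Y" "L \<ge> 1"
    and "\<And>x y. x \<in> X \<Longrightarrow> y \<in> X \<Longrightarrow> d x y \<le> L * e (f x) (f y)"
    and "\<And>x y. x \<in> X \<Longrightarrow> y \<in> X \<Longrightarrow> e (f x) (f y) \<le> L * d x y"
  shows "bilip_equiv X d Y e"
  using assms unfolding bilip_equiv_def by (intro exI[of _ f] exI[of _ L]) simp

lemma bilip_equiv_sym:
  assumes "bilip_equiv X d Y e"
  shows "bilip_equiv Y e X d"
proof -
  obtain f L where f: "bij_betw f X Y" "L \<ge> 1"
    "\<forall>x\<in>X. \<forall>y\<in>X. d x y \<le> L * e (f x) (f y) \<and> e (f x) (f y) \<le> L * d x y"
    using assms unfolding bilip_equiv_def by (elim exE conjE)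
  let ?g = "inv_into X f"
  have g: "?g y \<in> X \<and> f (?g y) = y" if "y \<in> Y" for y
    using f(1) that by (simp add: bij_betw_def inv_into_into f_inv_into_f)
  show ?thesis
  proof (rule bilip_equivI[OF bij_betw_inv_into[OF f(1)] f(2)])
    fix x y assume "x \<in> Y" "y \<in> Y"
    then show "e x y \<le> L * d (?g x) (?g y)" "d (?g x) (?g y) \<le> L * e x y"
      using f(3)[rule_format, of "?g x" "?g y"] g[of x] g[of y] by simp_all
  qed
qed

lemma bilip_equiv_trans:
  assumes "bilip_equiv X d Y e" "bilip_equiv Y e Z h"
  shows "bilip_equiv X d Z h"
proof -
  obtain f L where f: "bij_betw f X Y" "L \<ge> 1"
    "\<forall>x\<in>X. \<forall>y\<in>X. d x y \<le> L * e (f x) (f y) \<and> e (f x) (f y) \<le> L * d x y"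
    using assms(1) unfolding bilip_equiv_def by (elim exE conjE)
  obtain g M where g: "bij_betw g Y Z" "M \<ge> 1"
    "\<forall>x\<in>Y. \<forall>y\<in>Y. e x y \<le> M * h (g x) (g y) \<and> h (g x) (g y) \<le> M * e x y"
    using assms(2) unfolding bilip_equiv_def by (elim exE conjE)
  show ?thesis
  proof (rule bilip_equivI[OF bij_betw_trans[OF f(1) g(1)]])
    show "1 \<le> L * M" using f(2) g(2) mult_mono[of 1 L 1 M] by simp
    fix x y assume xy: "x \<in> X" "y \<in> X"
    then have "f x \<in> Y" "f y \<in> Y" using bij_betwE[OF f(1)] by blast+
    then have e: "e (f x) (f y) \<le> M * h (g (f x)) (g (f y))" "h (g (f x)) (g (f y)) \<le> M * e (f x) (f y)"
      using g(3) by blast+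
    have d: "d x y \<le> L * e (f x) (f y)" "e (f x) (f y) \<le> L * d x y" using f(3) xy by blast+
    show "d x y \<le> L * M * h ((g \<circ> f) x) ((g \<circ> f) y)"
      using order_trans[OF d(1) mult_left_mono[OF e(1), of L]] f(2) by (simp add: mult.assoc)
    show "h ((g \<circ> f) x) ((g \<circ> f) y) \<le> L * M * d x y"
      using order_trans[OF e(2) mult_left_mono[OF d(2), of M]] g(2) by (simp add: mult.assoc mult.left_commute)
  qed
qed

lemma Lipschitz_equivalent_iff: "Lipschitz_equivalent X Y \<longleftrightarrow> bilip_equiv X dist Y dist"
proof -
  have "inverse L * a \<le> b \<longleftrightarrow> a \<le> L * b" if "1 \<le> L" for L a b :: real
    using that by (simp add: field_simps)
  then show ?thesis unfolding Lipschitz_equivalent_def bilip_equiv_def by (metis (no_types, lifting))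
qed

section \<open>Clopen subsets and limits of maps\<close>

text \<open>The union of C, wC, wwC, ...: what a Hilbert hotel with shift w has to move in order to
  vacate C.\<close>

inductive_set spread :: "'a list \<Rightarrow> 'a stream set \<Rightarrow> 'a stream set" for w C where
  base: "z \<in> C \<Longrightarrow> z \<in> spread w C"
| step: "z \<in> spread w C \<Longrightarrow> w @- z \<in> spread w C"

context alphabet
begin

text \<open>A point of U and one outside U differ within N letters, so all distances in the base
  case lie between k and 1; one factor \<open>rmin ^ N\<close> of k pays for the prefix w, the other
  for the disagreement. In the induction step a common prefix w cancels and the induction hypothesis
  applies; if y does not begin with w, both distances again lie between k and 1.\<close>

lemma sdist_spread:
  assumes w: "w \<in> lists A" "length w = N" and UA: "U \<subseteq> streams A"
    and clopen: "\<And>x y. x \<in> U \<Longrightarrow> y \<in> streams A \<Longrightarrow> stake N x = stake N y \<Longrightarrow> y \<in> U"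
    and x: "x \<in> spread w (streams A - U)"
    and y: "y \<in> streams A" "y \<notin> spread w (streams A - U)"
  defines "k \<equiv> rmin ^ N * rmin ^ N"
  shows "x \<in> streams A \<and> k * sdist r x y \<le> sdist r (w @- x) y \<and> k * sdist r (w @- x) y \<le> sdist r x y"
  using x y
proof (induct x arbitrary: y)
  note rN = weight_ge_pow[OF w(1), unfolded w(2)]
  have pN: "0 < rmin ^ N" "rmin ^ N \<le> 1" and k: "k \<le> rmin ^ N" "0 < k"
    using rmin_pos rmin_less_1 by (auto simp: k_def power_le_one mult_left_le)
  have comparable: "k * a \<le> b \<and> k * b \<le> a" if "k \<le> a" "a \<le> 1" "k \<le> b" "b \<le> 1" for a b
    using that k mult_left_le[of a k] mult_left_le[of b k] by linarith
  have far: "k \<le> sdist r x y" if "x \<in> streams A" "stake N x \<noteq> stake N y" for x y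
    using sdist_ge_pow[OF that] k by simp
  {
    case (base z)
    have z: "z \<in> streams A" "w @- z \<in> streams A"
      using base w by (auto simp: shift_in_streams_iff)
    have yU: "y' \<in> U" if "y' \<in> streams A" "y' \<notin> spread w (streams A - U)" for y'
      using that spread.base[of y' "streams A - U" w] by blast
    have ne: "stake N z \<noteq> stake N y'" if "y' \<in> U" for y'
      using clopen[OF that, of z] base by auto
    have "k \<le> sdist r (w @- z) y"
    proof (cases "stake N y = w")
      case True
      then obtain y' where y': "y = w @- y'" using w(2) stake_length_eqD by metis
      then have "y' \<notin> spread w (streams A - U)" "y' \<in> streams A"
        using base spread.step by (auto simp: shift_in_streams_iff)
      then have "rmin ^ N \<le> sdist r z y'"
        using sdist_ge_pow[OF z(1) ne[OF yU]] by blast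
      then have "k \<le> weight r w * sdist r z y'"
        unfolding k_def using rN pN by (intro mult_mono) auto
      then show ?thesis using y' by simp
    next
      case False
      then show ?thesis using far[OF z(2)] w(2) by (auto simp: stake_shift)
    qed
    with comparable[OF far[OF z(1) ne[OF yU[OF base(2,3)]]]] sdist_le_1 z
    show ?case by blast
  next
    case (step z)
    have "z \<in> streams A"
      using step(1) by induct (use w in \<open>auto simp: shift_in_streams_iff\<close>)
    then have z: "w @- z \<in> streams A" "w @- w @- z \<in> streams A"
      using w by (auto simp: shift_in_streams_iff)
    show ?case
    proof (cases "stake N y = w")
      case True
      then obtain y' where y': "y = w @- y'" using w(2) stake_length_eqD by metis
      then have "y' \<notin> spread w (streams A - U)" "y' \<in> streams A"
        using step spread.step by (auto simp: shift_in_streams_iff)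
      then show ?thesis using step(2)[of y'] y' z weight_pos[OF w(1)]
        by (auto simp: mult.left_commute[of k])
    next
      case False
      then have "stake N (w @- z) \<noteq> stake N y" "stake N (w @- w @- z) \<noteq> stake N y"
        using w(2) by (auto simp: stake_shift)
      then show ?thesis using comparable far sdist_le_1 z by blast
    qed
  }
qed

text \<open>Hilbert hotel: shifting by w moves the complement of U into U, its image further into U,
  and so on, while all other points stay fixed. The N-letter prefix w of any point of U serves, as U
  then contains the whole cylinder of w.\<close>

lemma clopen_sdist_equiv:
  assumes UA: "U \<subseteq> streams A" and "U \<noteq> {}"
    and clopen: "\<And>x y. x \<in> U \<Longrightarrow> y \<in> streams A \<Longrightarrow> stake N x = stake N y \<Longrightarrow> y \<in> U"
  shows "bilip_equiv (streams A) (sdist r) U (sdist r)"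
proof -
  from \<open>U \<noteq> {}\<close> obtain p where p: "p \<in> U" by blast
  define w where "w = stake N p"
  have w: "w \<in> lists A" "length w = N" unfolding w_def using stake_in_lists[of p A N] p UA by auto
  define W where "W = spread w (streams A - U)"
  define k where "k = rmin ^ N * rmin ^ N"
  have k: "0 < k" "k \<le> weight r w" "k \<le> 1"
    using weight_ge_pow[OF w(1)] w(2) rmin_pos rmin_less_1 power_le_one[of rmin N]
    by (auto simp: k_def mult_left_le intro: order_trans[of _ "rmin ^ N"] mult_le_one)
  have wU: "w @- x \<in> U" if "x \<in> streams A" for x
    by (rule clopen[OF p]) (use that w in \<open>auto simp: shift_in_streams_iff w_def[symmetric] stake_shift\<close>)
  have WA: "x \<in> streams A" if "x \<in> W" for x
    using that unfolding W_def by induct (use w in \<open>auto simp: shift_in_streams_iff\<close>)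
  have cross: "k * sdist r x y \<le> sdist r (w @- x) y \<and> k * sdist r (w @- x) y \<le> sdist r x y"
    if "x \<in> W" "y \<in> streams A" "y \<notin> W" for x y
    using sdist_spread[OF w UA _ that(1)[unfolded W_def] that(2) that(3)[unfolded W_def]] clopen
    unfolding k_def by blast
  define h where "h = (\<lambda>x. if x \<in> W then w @- x else x)"
  have hW: "h x \<in> W" if "x \<in> W" for x
    using that by (auto simp: h_def W_def intro: spread.step)
  have "inj_on h (streams A)"
    using hW by (intro inj_onI) (metis h_def shift_left_inj)
  moreover have "h ` streams A = U"
  proof
    show "h ` streams A \<subseteq> U"
      using wU by (auto simp: h_def W_def intro: spread.base)
    show "U \<subseteq> h ` streams A"
    proof
      fix y assume y: "y \<in> U"
      show "y \<in> h ` streams A"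
      proof (cases "y \<in> W")
        \<comment> \<open>A point of U lies outside the complement of U, so it entered W by
          \<open>spread.step\<close>.\<close>
        case True
        then obtain z where "z \<in> W" "y = w @- z"
          using y unfolding W_def by (cases rule: spread.cases) auto
        then show ?thesis using WA by (auto simp: h_def intro!: image_eqI[of _ _ z])
      next
        case False then show ?thesis using y UA by (auto simp: h_def intro!: image_eqI[of _ _ y])
      qed
    qed
  qed
  ultimately have "bij_betw h (streams A) U" by (simp add: bij_betw_def)
  moreover have "sdist r x y \<le> 1 / k * sdist r (h x) (h y) \<and> sdist r (h x) (h y) \<le> 1 / k * sdist r x y"
    if xy: "x \<in> streams A" "y \<in> streams A" for x y
  proof -
    \<comment> \<open>Within W distances are multiplied by the weight of w, outside W nothing moves;
      only mixed pairs need \<open>cross\<close>.\<close>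
    have same: "k * a \<le> a" "k * a \<le> weight r w * a" "k * (weight r w * a) \<le> a" if "0 \<le> a" for a
      using that k weight_le_1[OF w(1)] weight_pos[OF w(1)]
      by (auto intro!: mult_right_mono mult_left_le_one_le simp: mult_le_one simp flip: mult.assoc)
    have "k * sdist r x y \<le> sdist r (h x) (h y) \<and> k * sdist r (h x) (h y) \<le> sdist r x y"
      using cross[of x y] cross[of y x] same[OF sdist_nonneg[OF xy(1), of y]] xy
      by (auto simp: h_def sdist_sym)
    then show ?thesis using k by (simp add: field_simps)
  qed
  moreover have "1 \<le> 1 / k" using k by simp
  ultimately show ?thesis by (intro bilip_equivI[of h _ _ "1 / k"]) simp_all
qed

end

(* A diagonal (Koenig) argument: both alphabets are finite, so for each k only finitely many
   maps arise as the first k letters of a member of an equicontinuous sequence. *)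
lemma equicontinuous_limit:
  fixes G :: "nat \<Rightarrow> 'b stream \<Rightarrow> 'a stream"
  assumes fin: "finite A" "finite B" and X: "X \<subseteq> streams B"
    and GA: "\<And>n x. x \<in> X \<Longrightarrow> G n x \<in> streams A"
    and equi: "\<And>k. \<exists>m. \<forall>n. \<forall>x\<in>X. \<forall>y\<in>X. stake m x = stake m y \<longrightarrow> stake k (G n x) = stake k (G n y)"
  obtains g where "\<And>x. x \<in> X \<Longrightarrow> g x \<in> streams A"
    "\<And>k N. \<exists>n\<ge>N. \<forall>x\<in>X. stake k (g x) = stake k (G n x)"
proof -
  define E where "E = (\<lambda>k n n'. \<forall>x\<in>X. stake k (G n x) = stake k (G n' x))"
  have refine: "\<exists>I'\<subseteq>I. infinite I' \<and> (\<forall>n\<in>I'. \<forall>n'\<in>I'. E k n n')" if I: "infinite I" for I k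
  proof -
    from equi[of k] obtain m where
      m: "\<And>n x y. x \<in> X \<Longrightarrow> y \<in> X \<Longrightarrow> stake m x = stake m y \<Longrightarrow> stake k (G n x) = stake k (G n y)"
      by blast
    define D where "D = stake m ` X"
    define \<rho> where "\<rho> = (\<lambda>u. SOME x. x \<in> X \<and> stake m x = u)"
    have rep: "\<rho> u \<in> X \<and> stake m (\<rho> u) = u" if u: "u \<in> D" for u
    proof -
      from u obtain x where "x \<in> X \<and> stake m x = u" by (auto simp: D_def)
      then show ?thesis unfolding \<rho>_def by (rule someI)
    qed
    \<comment> \<open>\<open>P n\<close> is a finite record that decides the first k letters of all
      values of \<open>G n\<close>: by equicontinuity one representative for each prefix of length m
      suffices.\<close>
    define P where "P = (\<lambda>n. \<lambda>u\<in>D. stake k (G n (\<rho> u)))"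
    have "D \<subseteq> {w \<in> lists B. length w = m}"
    proof
      fix u assume "u \<in> D"
      then obtain x where "x \<in> X" "u = stake m x" by (auto simp: D_def)
      then show "u \<in> {w \<in> lists B. length w = m}" using stake_in_lists[of x B m] X by auto
    qed
    then have "finite D" using finite_words[OF fin(2)] finite_subset by blast
    moreover have "P n \<in> D \<rightarrow>\<^sub>E {w \<in> lists A. length w = k}" for n
    proof (rule PiE_I)
      fix u assume "u \<in> D"
      then have "G n (\<rho> u) \<in> streams A" using rep GA by blast
      with \<open>u \<in> D\<close> show "P n u \<in> {w \<in> lists A. length w = k}"
        using stake_in_lists[of "G n (\<rho> u)" A k] by (simp add: P_def)
    qed (simp add: P_def)
    ultimately have "finite (P ` I)"
      using finite_words[OF fin(1)] by (meson finite_PiE finite_subset image_subsetI)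
    then obtain n0 where "infinite {n \<in> I. P n = P n0}"
      using pigeonhole_infinite[OF I] by blast
    moreover have "E k n n'" if "P n = P n0" "P n' = P n0" for n n'
      unfolding E_def
    proof
      fix x assume x: "x \<in> X"
      then have "stake m x \<in> D" by (simp add: D_def)
      then have "stake k (G n (\<rho> (stake m x))) = stake k (G n' (\<rho> (stake m x)))"
        using fun_cong[OF trans[OF that(1) that(2)[symmetric]], of "stake m x"] by (simp add: P_def)
      then show "stake k (G n x) = stake k (G n' x)"
        using m[OF x] rep[OF \<open>stake m x \<in> D\<close>] by metis
    qed
    ultimately show ?thesis
      by (intro exI[of _ "{n \<in> I. P n = P n0}"] conjI ballI) (simp_all only: mem_Collect_eq, simp_all)
  qed
  have "\<exists>I. \<forall>k. (infinite (I k) \<and> (\<forall>n\<in>I k. \<forall>n'\<in>I k. E k n n')) \<and> I (Suc k) \<subseteq> I k"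
  proof (rule dependent_nat_choice)
    show "\<exists>I. infinite I \<and> (\<forall>n\<in>I. \<forall>n'\<in>I. E 0 n n')"
      using refine[OF infinite_UNIV_nat, of 0] by auto
    show "\<exists>I'. (infinite I' \<and> (\<forall>n\<in>I'. \<forall>n'\<in>I'. E (Suc k) n n')) \<and> I' \<subseteq> I"
      if "infinite I \<and> (\<forall>n\<in>I. \<forall>n'\<in>I. E k n n')" for I k
    proof -
      from refine[of I "Suc k"] that obtain I' where
        "I' \<subseteq> I" "infinite I'" "\<forall>n\<in>I'. \<forall>n'\<in>I'. E (Suc k) n n'" by auto
      then show ?thesis by (intro exI[of _ I'] conjI)
    qed
  qed
  then obtain I where I: "\<forall>k. (infinite (I k) \<and> (\<forall>n\<in>I k. \<forall>n'\<in>I k. E k n n')) \<and> I (Suc k) \<subseteq> I k" ..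
  have inf: "infinite (I k)" and E: "n \<in> I k \<Longrightarrow> n' \<in> I k \<Longrightarrow> E k n n'" and dec: "I (Suc k) \<subseteq> I k" for k n n'
    using I[rule_format, of k] by simp_all
  have "\<exists>n\<ge>k. n \<in> I k" for k
    using inf[of k] by (simp add: infinite_nat_iff_unbounded_le)
  then obtain \<nu> where \<nu>: "\<And>k. \<nu> k \<ge> k" "\<And>k. \<nu> k \<in> I k" by metis
  have I_mono: "I l \<subseteq> I k" if "k \<le> l" for k l
    using dec that by (rule lift_Suc_antimono_le)
  \<comment> \<open>The diagonal map. Letter k is read at an index in \<open>I (Suc k)\<close>,
    because agreement within \<open>I (Suc k)\<close> covers the letters 0 to k.\<close>
  define g where "g = (\<lambda>x. smap (\<lambda>k. G (\<nu> (Suc k)) x !! k) nats)"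
  show ?thesis
  proof
    show "g x \<in> streams A" if "x \<in> X" for x
      using GA[OF that] by (auto simp: streams_iff_snth g_def)
    fix k N
    have "stake k (g x) = stake k (G (\<nu> (max k N)) x)" if "x \<in> X" for x
      unfolding stake_eq_iff
    proof (intro allI impI)
      fix i assume "i < k"
      then have "Suc i \<le> max k N" by simp
      then have "\<nu> (max k N) \<in> I (Suc i)" using I_mono \<nu>(2) by blast
      then have "stake (Suc i) (G (\<nu> (Suc i)) x) = stake (Suc i) (G (\<nu> (max k N)) x)"
        using E[OF \<nu>(2)] that unfolding E_def by blast
      then show "g x !! i = G (\<nu> (max k N)) x !! i" unfolding stake_eq_iff by (simp add: g_def)
    qed
    then show "\<exists>n\<ge>N. \<forall>x\<in>X. stake k (g x) = stake k (G n x)"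
      using \<nu>(1)[of "max k N"] by (intro exI[of _ "\<nu> (max k N)"]) auto
  qed
qed

text \<open>Compactness of the stream space, as the case of constant maps on a one-point
  domain.\<close>

lemma streams_cluster_point:
  fixes x :: "nat \<Rightarrow> 'a stream"
  assumes "finite A" "\<And>n. x n \<in> streams A"
  shows "\<exists>y\<in>streams A. \<forall>k N. \<exists>n\<ge>N. stake k y = stake k (x n)"
proof -
  obtain g where g: "\<And>z. z \<in> {x 0} \<Longrightarrow> g z \<in> streams A"
    "\<And>k N. \<exists>n\<ge>N. \<forall>z\<in>{x 0}. stake k (g z) = stake k (x n)"
    by (rule equicontinuous_limit[of A A "{x 0}" "\<lambda>n _. x n"]) (use assms in auto)
  then show ?thesis by (intro bexI[of _ "g (x 0)"]) auto
qed

section \<open>Bilipschitz bijections between symbolic spaces\<close>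

text \<open>Characterised by maximality instead of being computed; meaningful as soon as X contains
  two streams.\<close>

definition lcp :: "'a stream set \<Rightarrow> 'a list" where
  "lcp X = (SOME w. (\<forall>x\<in>X. stake (length w) x = w) \<and> (\<exists>x\<in>X. \<exists>y\<in>X. x !! length w \<noteq> y !! length w))"

lemma lcp:
  assumes "x \<in> X" "y \<in> X" "x \<noteq> y"
  shows "(\<forall>x\<in>X. stake (length (lcp X)) x = lcp X) \<and> (\<exists>x\<in>X. \<exists>y\<in>X. x !! length (lcp X) \<noteq> y !! length (lcp X))"
proof -
  define P where "P = (\<lambda>n. \<exists>x\<in>X. \<exists>y\<in>X. x !! n \<noteq> y !! n)"
  from stream_split[OF assms(3)] obtain n where "x !! n \<noteq> y !! n" by blast
  then have "P n" using assms unfolding P_def by blast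
  then have P: "P (LEAST n. P n)" "\<not> P i" if "i < (LEAST n. P n)" for i
    using that by (auto intro: LeastI dest: not_less_Least)
  have PL: "P (LEAST n. P n)" using \<open>P n\<close> by (rule LeastI)
  let ?w = "stake (LEAST n. P n) x"
  have "\<forall>z\<in>X. stake (length ?w) z = ?w"
    using P(2) assms(1) unfolding P_def length_stake stake_eq_iff by blast
  moreover have "\<exists>x\<in>X. \<exists>y\<in>X. x !! length ?w \<noteq> y !! length ?w"
    using PL by (simp add: P_def)
  ultimately show ?thesis
    unfolding lcp_def by (rule someI[where x = ?w, OF conjI])
qed

lemma prefix_of_stake:
  assumes "stake (length u) x = u" "stake (length v) x = v" "length u \<le> length v"
  shows "\<exists>w. v = u @ w"
  using assms stake_le_append[OF assms(3), of x] by (metis stake_add)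

text \<open>Two letters on each side put two streams into every cylinder, so that common prefixes of
  images exist for f and for its inverse alike.\<close>

locale sim_bij = A: alphabet A r + B: alphabet B t
  for A :: "'a set" and r and B :: "'b set" and t +
  fixes f :: "'a stream \<Rightarrow> 'b stream" and L :: real
  assumes bij: "bij_betw f (streams A) (streams B)"
    and L_ge_1: "1 \<le> L"
    and lower: "x \<in> streams A \<Longrightarrow> y \<in> streams A \<Longrightarrow> sdist r x y \<le> L * sdist t (f x) (f y)"
    and upper: "x \<in> streams A \<Longrightarrow> y \<in> streams A \<Longrightarrow> sdist t (f x) (f y) \<le> L * sdist r x y"
    and two_A: "2 \<le> card A" and two_B: "2 \<le> card B"
begin

lemma inverse: "sim_bij B t A r (inv_into (streams A) f) L"
proof
  have g: "inv_into (streams A) f y \<in> streams A \<and> f (inv_into (streams A) f y) = y" if "y \<in> streams B" for y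
    using bij that by (simp add: bij_betw_def inv_into_into f_inv_into_f)
  show "sdist t x y \<le> L * sdist r (inv_into (streams A) f x) (inv_into (streams A) f y)"
    "sdist r (inv_into (streams A) f x) (inv_into (streams A) f y) \<le> L * sdist t x y"
    if "x \<in> streams B" "y \<in> streams B" for x y
    using g[OF that(1)] g[OF that(2)] lower upper by metis+
qed (use bij L_ge_1 two_A two_B bij_betw_inv_into in auto)

lemma f_in: "x \<in> streams A \<Longrightarrow> f x \<in> streams B"
  using bij by (auto simp: bij_betw_def)

lemma f_eq_iff: "x \<in> streams A \<Longrightarrow> y \<in> streams A \<Longrightarrow> f x = f y \<longleftrightarrow> x = y"
  using bij by (auto simp: bij_betw_def inj_on_eq_iff)

lemma f_surj: "y \<in> streams B \<Longrightarrow> \<exists>x\<in>streams A. f x = y"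
  using bij unfolding bij_betw_def by (metis imageE)

definition img :: "'a list \<Rightarrow> 'b stream set" where
  "img I = (\<lambda>x. f (I @- x)) ` streams A"

definition J :: "'a list \<Rightarrow> 'b list" where
  "J I = lcp (img I)"

lemma two_letters: obtains a b where "a \<in> A" "b \<in> A" "a \<noteq> b"
  using two_A card_le_Suc0_iff_eq[OF A.finite_alphabet] by force

lemma img_sub: "I \<in> lists A \<Longrightarrow> img I \<subseteq> streams B"
  by (auto simp: img_def shift_in_streams_iff intro!: f_in)

lemma J_lcp:
  assumes I: "I \<in> lists A"
  shows "(\<forall>y\<in>img I. stake (length (J I)) y = J I) \<and> (\<exists>x\<in>img I. \<exists>y\<in>img I. x !! length (J I) \<noteq> y !! length (J I))"
proof -
  obtain a b where ab: "a \<in> A" "b \<in> A" "a \<noteq> b" by (rule two_letters)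
  have "sconst a \<noteq> sconst b" using ab(3) sset_sconst by (metis singleton_inject)
  then have "f (I @- sconst a) \<noteq> f (I @- sconst b)"
    using ab I f_eq_iff[of "I @- sconst a" "I @- sconst b"]
    by (auto simp: shift_in_streams_iff sconst_streams)
  then show ?thesis unfolding J_def
    by (rule lcp[rotated 2]) (use ab in \<open>auto simp: img_def sconst_streams\<close>)
qed

lemma J_prefix: "I \<in> lists A \<Longrightarrow> x \<in> streams A \<Longrightarrow> stake (length (J I)) (f (I @- x)) = J I"
  using J_lcp by (auto simp: img_def)

lemma J_in: "I \<in> lists A \<Longrightarrow> J I \<in> lists B"
proof -
  assume I: "I \<in> lists A"
  obtain a where "a \<in> A" by (rule two_letters)
  then have "f (I @- sconst a) \<in> streams B" using I by (auto intro!: f_in simp: shift_in_streams_iff sconst_streams)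
  from stake_in_lists[OF this, of "length (J I)"] show ?thesis
    using J_prefix[OF I sconst_streams[OF \<open>a \<in> A\<close>]] by simp
qed

lemma J_split:
  assumes I: "I \<in> lists A"
  obtains x y where "x \<in> streams A" "y \<in> streams A" "f (I @- x) !! length (J I) \<noteq> f (I @- y) !! length (J I)"
    "sdist t (f (I @- x)) (f (I @- y)) = weight t (J I)"
proof -
  obtain x y where xy: "x \<in> streams A" "y \<in> streams A" "f (I @- x) !! length (J I) \<noteq> f (I @- y) !! length (J I)"
    using J_lcp[OF I] by (auto simp: img_def)
  then have "sdist t (f (I @- x)) (f (I @- y)) = weight t (J I)"
    using sdist_eqI[OF _ xy(3), of t] J_prefix[OF I] by simp
  with xy show ?thesis by (rule that)
qed

text \<open>The weights of I and \<open>J I\<close> are the diameters of a cylinder and of its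
  image, and both are attained: here at two streams whose images separate right after
  \<open>J I\<close>, in \<open>J_lower\<close> at two constant tails.\<close>

lemma J_upper: "weight t (J I) \<le> L * weight r I" if I: "I \<in> lists A"
proof -
  obtain x y where xy: "x \<in> streams A" "y \<in> streams A" "sdist t (f (I @- x)) (f (I @- y)) = weight t (J I)"
    using J_split[OF I] by metis
  then have "weight t (J I) \<le> L * (weight r I * sdist r x y)"
    using upper[of "I @- x" "I @- y"] I by (auto simp: shift_in_streams_iff)
  also have "\<dots> \<le> L * (weight r I * 1)"
    using L_ge_1 A.weight_pos[OF I] A.sdist_le_1[OF xy(1), of y] by (intro mult_left_mono) auto
  finally show ?thesis by simp
qed

lemma J_lower: "weight r I \<le> L * weight t (J I)" if I: "I \<in> lists A"
proof -
  obtain a b where ab: "a \<in> A" "b \<in> A" "a \<noteq> b" by (rule two_letters)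
  let ?x = "I @- sconst a" and ?y = "I @- sconst b"
  have xy: "?x \<in> streams A" "?y \<in> streams A" using I ab by (auto simp: shift_in_streams_iff sconst_streams)
  have "sdist r (sconst a) (sconst b) = 1"
    using sdist_eqI[of 0 "sconst a" "sconst b" r] ab by simp
  then have "weight r I \<le> L * sdist t (f ?x) (f ?y)"
    using lower[OF xy] by simp
  also have "\<dots> \<le> L * weight t (J I)"
    using L_ge_1 B.sdist_le[OF f_in[OF xy(1)], of "length (J I)" "f ?y"] J_prefix[OF I] ab
    by (intro mult_left_mono) (auto simp: sconst_streams)
  finally show ?thesis .
qed

text \<open>The images below \<open>I @ K\<close> all begin with \<open>J I\<close>, and two of them
  separate right after \<open>J (I @ K)\<close>, which therefore cannot be the shorter word.\<close>

lemma J_append: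
  assumes I: "I \<in> lists A" and K: "K \<in> lists A"
  shows "\<exists>u\<in>lists B. J (I @ K) = J I @ u"
proof -
  have IK: "I @ K \<in> lists A" using I K by simp
  obtain x y where xy: "x \<in> streams A" "y \<in> streams A"
    "f ((I @ K) @- x) !! length (J (I @ K)) \<noteq> f ((I @ K) @- y) !! length (J (I @ K))"
    using J_split[OF IK] by metis
  have pre: "stake (length (J I)) (f ((I @ K) @- z)) = J I" if "z \<in> streams A" for z
    using J_prefix[OF I, of "K @- z"] K that by (simp add: shift_in_streams_iff)
  have "\<not> length (J (I @ K)) < length (J I)"
    using pre[OF xy(1)] pre[OF xy(2)] xy(3) stake_eq_iff by metis
  then obtain u where u: "J (I @ K) = J I @ u"
    using prefix_of_stake[OF pre[OF xy(1)] J_prefix[OF IK xy(1)]] by auto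
  with J_in[OF IK] show ?thesis by auto
qed

text \<open>Images of cylinders are open, with a radius proportional to the weight: the preimage of
  y is too close to \<open>I @- x\<close> to leave the cylinder of I.\<close>

lemma img_open:
  assumes "I \<in> lists A" "x \<in> streams A" "y \<in> streams B" "L * sdist t (f (I @- x)) y < weight r I"
  obtains x' where "x' \<in> streams A" "y = f (I @- x')"
proof -
  obtain z where z: "z \<in> streams A" "f z = y" using f_surj[OF assms(3)] by blast
  have Ix: "I @- x \<in> streams A" using assms by (simp add: shift_in_streams_iff)
  have "sdist r (I @- x) z < weight r (stake (length I) (I @- x))"
    using lower[OF Ix z(1)] z(2) assms(4) by simp
  then have "stake (length I) z = I"
    using A.sdist_greater[OF Ix, of "length I" z] by force
  then have "z = I @- sdrop (length I) z" by (rule stake_length_eqD)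
  then show ?thesis using that[of "sdrop (length I) z"] sdrop_in_streams[OF z(1)] z(2) by simp
qed

end

text \<open>The argument of Falconer and Marsh: the ratios of a value to the value at the parent range over a
  finite set, so close to the supremum no child can exceed its parent; being averages, the values are then constant.\<close>

lemma constant_branch:
  fixes \<phi> :: "'a list \<Rightarrow> real" and p :: "'a \<Rightarrow> real"
  assumes A: "finite A" and p: "\<And>i. i \<in> A \<Longrightarrow> 0 < p i"
    and avg: "\<And>I. I \<in> lists A \<Longrightarrow> \<phi> I = (\<Sum>i\<in>A. p i * \<phi> (I @ [i]))"
    and bounds: "\<And>I. I \<in> lists A \<Longrightarrow> c \<le> \<phi> I \<and> \<phi> I \<le> C" and c: "0 < c"
    and fin: "finite \<Psi>" "\<And>I i. I \<in> lists A \<Longrightarrow> i \<in> A \<Longrightarrow> \<phi> (I @ [i]) / \<phi> I \<in> \<Psi>"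
  shows "\<exists>I\<in>lists A. \<forall>K\<in>lists A. \<phi> (I @ K) = \<phi> I"
proof -
  let ?\<Phi> = "\<phi> ` lists A"
  define \<rho> where "\<rho> = sum p A"
  define M where "M = Sup ?\<Phi>"
  have ne: "?\<Phi> \<noteq> {}" by auto
  have above: "bdd_above ?\<Phi>" using bounds by (auto intro!: bdd_aboveI[of _ C])
  have below: "bdd_below ?\<Phi>" using bounds by (auto intro!: bdd_belowI[of _ c])
  have le_M: "\<phi> I \<le> M" if "I \<in> lists A" for I
    unfolding M_def using that above by (intro cSup_upper) auto
  have \<rho>_nonneg: "0 \<le> \<rho>" unfolding \<rho>_def using p by (intro sum_nonneg) (auto simp: less_imp_le)
  \<comment> \<open>Averaging gives M \<le> \<rho> * M for the supremum and, further down, \<rho> *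
    m \<le> m for the infimum. So the \<open>p i\<close> sum to 1 and \<phi> is a true mean of its
    values at the children.\<close>
  have "1 \<le> \<rho>"
  proof -
    have "\<phi> I \<le> \<rho> * M" if I: "I \<in> lists A" for I
      unfolding avg[OF I] \<rho>_def sum_distrib_right
      by (rule sum_mono) (use p le_M I in \<open>auto intro!: mult_left_mono simp: less_imp_le\<close>)
    then have "M \<le> \<rho> * M" unfolding M_def using ne by (intro cSup_least) (auto simp: M_def)
    moreover have "0 < M" using le_M[of "[]"] bounds[of "[]"] c by auto
    ultimately show ?thesis by simp
  qed
  moreover have "\<rho> \<le> 1"
  proof -
    define m where "m = Inf ?\<Phi>"
    have m_le: "m \<le> \<phi> I" if "I \<in> lists A" for I
      unfolding m_def using that below by (intro cInf_lower) auto
    have "\<rho> * m \<le> \<phi> I" if I: "I \<in> lists A" for I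
      unfolding avg[OF I] \<rho>_def sum_distrib_right
      by (rule sum_mono) (use p m_le I in \<open>auto intro!: mult_left_mono simp: less_imp_le\<close>)
    then have "\<rho> * m \<le> m" using ne by (subst (2) m_def, intro cInf_greatest) auto
    moreover have "c \<le> m" unfolding m_def using ne bounds by (intro cInf_greatest) auto
    ultimately show ?thesis using c by simp
  qed
  ultimately have \<rho>: "\<rho> = 1" by simp
  \<comment> \<open>The least ratio above 1 in the finite set; 2 is the default if there is
    none.\<close>
  define \<theta> where "\<theta> = Min (insert 2 {\<psi>\<in>\<Psi>. 1 < \<psi>})"
  have \<theta>: "1 < \<theta>" "\<And>\<psi>. \<psi> \<in> \<Psi> \<Longrightarrow> 1 < \<psi> \<Longrightarrow> \<theta> \<le> \<psi>"
    unfolding \<theta>_def using fin(1) by auto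
  have "0 < M" using le_M[of "[]"] bounds[of "[]"] c by auto
  then have "M / \<theta> < M" using \<theta>(1) by (simp add: field_simps)
  then obtain I where I: "I \<in> lists A" "M / \<theta> < \<phi> I"
    using less_cSup_iff[OF ne above] unfolding M_def by auto
  have child: "\<phi> (K @ [i]) = \<phi> K" if K: "K \<in> lists A" "M / \<theta> < \<phi> K" and i: "i \<in> A" for K i
  proof -
    have pos: "0 < \<phi> K" using bounds[OF K(1)] c by simp
    have le: "\<phi> (K @ [j]) \<le> \<phi> K" if "j \<in> A" for j
    proof (rule ccontr)
      assume "\<not> \<phi> (K @ [j]) \<le> \<phi> K"
      then have "1 < \<phi> (K @ [j]) / \<phi> K" using pos by simp
      then have "\<theta> \<le> \<phi> (K @ [j]) / \<phi> K" using \<theta>(2) fin(2)[OF K(1) that] by blast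
      then have "\<theta> * \<phi> K \<le> \<phi> (K @ [j])" using pos by (simp add: field_simps)
      moreover have "M < \<theta> * \<phi> K" using K(2) \<theta>(1) by (simp add: field_simps)
      ultimately show False using le_M[of "K @ [j]"] K(1) that by simp
    qed
    have "(\<Sum>j\<in>A. p j * (\<phi> K - \<phi> (K @ [j]))) = \<rho> * \<phi> K - \<phi> K"
      unfolding \<rho>_def using avg[OF K(1)] by (simp add: right_diff_distrib sum_subtractf sum_distrib_right)
    then have "(\<Sum>j\<in>A. p j * (\<phi> K - \<phi> (K @ [j]))) = 0" using \<rho> by simp
    then have "\<forall>j\<in>A. p j * (\<phi> K - \<phi> (K @ [j])) = 0"
      using A p le by (subst (asm) sum_nonneg_eq_0_iff) (auto simp: less_imp_le)
    then show ?thesis using i p[OF i] by auto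
  qed
  have "\<phi> (I @ K) = \<phi> I" if "K \<in> lists A" for K
    using that
  proof (induct K rule: rev_induct)
    case (snoc i K)
    then have "\<phi> (I @ K) = \<phi> I" by simp
    then show ?case using child[of "I @ K" i] snoc(2) I by simp
  qed simp
  then show ?thesis using I(1) by blast
qed

text \<open>Intermediate value theorem between the exponent 0, where the sum counts letters, and an
  exponent k making every term at most 1/n. The value s is the similarity dimension; it is 0 for a
  single letter, a case that occurs for the restricted alphabets.\<close>

lemma dimension_exists:
  fixes t :: "'b \<Rightarrow> real"
  assumes "alphabet B t" "B \<noteq> {}"
  shows "\<exists>s\<ge>0. (\<Sum>j\<in>B. t j powr s) = 1"
proof -
  interpret alphabet B t by fact
  define h where "h = (\<lambda>s. \<Sum>j\<in>B. t j powr s)"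
  define n where "n = real (card B)"
  have n: "1 \<le> n" using assms(2) finite_alphabet by (simp add: n_def Suc_le_eq card_gt_0_iff)
  have "h 0 = (\<Sum>j\<in>B. 1)"
    unfolding h_def by (rule sum.cong) (use ratio_pos in force)+
  then have h0: "h 0 = n" by (simp add: n_def)
  obtain k where k: "rmax ^ k < 1 / n" using rmax_pow_small[of "1 / n"] n by auto
  have "h k \<le> (\<Sum>j\<in>B. 1 / n)"
    unfolding h_def
  proof (rule sum_mono)
    fix j assume j: "j \<in> B"
    then have "t j powr real k = t j ^ k" using ratio_pos by (simp add: powr_realpow)
    also have "\<dots> \<le> rmax ^ k" using le_rmax[OF j] ratio_pos[OF j] by (intro power_mono) auto
    finally show "t j powr real k \<le> 1 / n" using k by simp
  qed
  also have "\<dots> = 1" using n by (simp add: n_def)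
  finally have hk: "h k \<le> 1" .
  have cyl_content: "continuous_on {0..real k} h"
    unfolding h_def by (intro continuous_intros) (use ratio_pos in force)
  from IVT2'[of h "real k" 1 0, OF hk _ _ cyl_content] h0 n show ?thesis
    by (auto simp: h_def)
qed

text \<open>Induction on the longest word: the words of U beginning with i, stripped of i, cover
  \<open>streams A\<close> again. Nested words in U only add to the sum.\<close>

lemma cover_weight_ge_1:
  fixes q :: "'a \<Rightarrow> real"
  assumes q: "\<And>i. i \<in> A \<Longrightarrow> 0 \<le> q i" "1 \<le> sum q A"
    and U: "finite U" "U \<subseteq> lists A" "\<And>x. x \<in> streams A \<Longrightarrow> \<exists>u\<in>U. stake (length u) x = u"
  shows "1 \<le> (\<Sum>u\<in>U. weight q u)"
proof -
  have A: "finite A" using q(2) by (metis sum.infinite not_one_le_zero)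
  have nonneg: "0 \<le> weight q u" if "u \<in> lists A" for u
    using that by (induct u) (auto simp: q(1))
  have "1 \<le> (\<Sum>u\<in>U. weight q u)" if "\<forall>u\<in>U. length u \<le> n"
    and U: "finite U" "U \<subseteq> lists A" "\<And>x. x \<in> streams A \<Longrightarrow> \<exists>u\<in>U. stake (length u) x = u" for n U
    using that
  proof (induct n arbitrary: U)
    case 0
    \<comment> \<open>All words being empty, some stream has to exist for the cover to contain a
      word at all.\<close>
    obtain a where "a \<in> A" using q(2) by force
    then have "[] \<in> U" using 0(4)[of "sconst a"] 0(1) by (auto simp: sconst_streams)
    then have "weight q [] \<le> (\<Sum>u\<in>U. weight q u)"
      using 0(2,3) by (intro member_le_sum nonneg) blast+
    then show ?case by simp
  next
    case (Suc n)
    show ?case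
    proof (cases "[] \<in> U")
      case True
      then have "weight q [] \<le> (\<Sum>u\<in>U. weight q u)"
        using Suc(3,4) by (intro member_le_sum nonneg) blast+
      then show ?thesis by simp
    next
      case False
      define V where "V = (\<lambda>i. {v. i # v \<in> U})"
      have fV: "finite (V i)" for i
      proof -
        have "V i \<subseteq> tl ` U" by (force simp: V_def)
        then show ?thesis using Suc(3) finite_subset by blast
      qed
      have U_eq: "U = (\<Union>i\<in>A. (#) i ` V i)"
      proof
        show "U \<subseteq> (\<Union>i\<in>A. (#) i ` V i)"
        proof
          fix u assume u: "u \<in> U"
          then obtain i v where "u = i # v" using False by (cases u) auto
          moreover have "u \<in> lists A" using u Suc(4) by blast
          ultimately show "u \<in> (\<Union>i\<in>A. (#) i ` V i)" using u by (auto simp: V_def)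
        qed
      qed (auto simp: V_def)
      have ge: "1 \<le> (\<Sum>v\<in>V i. weight q v)" if i: "i \<in> A" for i
      proof (rule Suc(1))
        show "\<forall>u\<in>V i. length u \<le> n" using Suc(2) by (auto simp: V_def)
        show "V i \<subseteq> lists A" using Suc(4) by (auto simp: V_def)
        show "\<exists>u\<in>V i. stake (length u) x = u" if x: "x \<in> streams A" for x
        proof -
          obtain u where u: "u \<in> U" "stake (length u) (i ## x) = u" using Suc(5)[of "i ## x"] i x by auto
          then obtain j v where "u = j # v" using False by (cases u) auto
          then show ?thesis using u by (auto simp: V_def)
        qed
      qed (rule fV)
      have "1 \<le> (\<Sum>i\<in>A. q i * 1)" using q(2) by simp
      also have "\<dots> \<le> (\<Sum>i\<in>A. q i * (\<Sum>v\<in>V i. weight q v))"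
        using ge q(1) by (intro sum_mono mult_left_mono) auto
      also have "\<dots> = (\<Sum>i\<in>A. \<Sum>u\<in>(#) i ` V i. weight q u)"
        by (intro sum.cong refl) (simp add: sum.reindex sum_distrib_left)
      also have "\<dots> = (\<Sum>u\<in>U. weight q u)"
        unfolding U_eq using A fV by (intro sum.UNION_disjoint[symmetric]) auto
      finally show ?thesis .
    qed
  qed
  moreover obtain n where "\<forall>u\<in>U. length u \<le> n"
    using U(1) by (meson finite_imageI finite_nat_set_iff_bounded_le imageI)
  ultimately show ?thesis using U by blast
qed

text \<open>For q of total mass 1 this is the Bernoulli measure of C as soon as C is a union of
  cylinders of length n. Finite sums suffice, as the sets measured below are of this kind.\<close>

definition cyl_content :: "('b \<Rightarrow> real) \<Rightarrow> nat \<Rightarrow> 'b stream set \<Rightarrow> real" where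
  "cyl_content q n C = (\<Sum>w\<in>stake n ` C. weight q w)"

definition determined :: "'b set \<Rightarrow> nat \<Rightarrow> 'b stream set \<Rightarrow> bool" where
  "determined B n C \<longleftrightarrow> C \<subseteq> streams B \<and> (\<forall>y\<in>C. \<forall>y'\<in>streams B. stake n y = stake n y' \<longrightarrow> y' \<in> C)"

lemma determined_mono: "determined B n C \<Longrightarrow> n \<le> m \<Longrightarrow> determined B m C"
  unfolding determined_def using stake_eq_mono by blast

lemma finite_stake_image:
  assumes "finite B" "C \<subseteq> streams B"
  shows "finite (stake n ` C)" "stake n ` C \<subseteq> {w \<in> lists B. length w = n}"
proof -
  show sub: "stake n ` C \<subseteq> {w \<in> lists B. length w = n}"
  proof
    fix w assume "w \<in> stake n ` C"
    then obtain y where "y \<in> C" "w = stake n y" by blast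
    then show "w \<in> {w \<in> lists B. length w = n}"
      using stake_in_lists[of y B n] assms(2) by auto
  qed
  show "finite (stake n ` C)" using sub finite_words[OF assms(1)] by (rule finite_subset)
qed

lemma cyl_content_Suc:
  assumes "finite B" "sum q B = 1" "determined B n C"
  shows "cyl_content q (Suc n) C = cyl_content q n C"
proof -
  have CB: "C \<subseteq> streams B" using assms(3) by (simp add: determined_def)
  have "stake (Suc n) ` C = (\<lambda>(w, b). w @ [b]) ` (stake n ` C \<times> B)"
  proof
    show "stake (Suc n) ` C \<subseteq> (\<lambda>(w, b). w @ [b]) ` (stake n ` C \<times> B)"
    proof
      fix w assume "w \<in> stake (Suc n) ` C"
      then obtain y where y: "y \<in> C" "w = stake n y @ [y !! n]"
        unfolding stake_Suc by blast
      then show "w \<in> (\<lambda>(w, b). w @ [b]) ` (stake n ` C \<times> B)"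
        using CB snth_in[of y B n] by (intro image_eqI[of _ _ "(stake n y, y !! n)"]) auto
    qed
    show "(\<lambda>(w, b). w @ [b]) ` (stake n ` C \<times> B) \<subseteq> stake (Suc n) ` C"
    proof
      fix v assume "v \<in> (\<lambda>(w, b). w @ [b]) ` (stake n ` C \<times> B)"
      then obtain y b where y: "y \<in> C" "b \<in> B" "v = stake n y @ [b]" by auto
      \<comment> \<open>The constant tail realises the extension by b as the prefix of a stream,
        which lies in C because it agrees with y on n letters.\<close>
      let ?y = "(stake n y @ [b]) @- sconst b"
      have "?y \<in> streams B"
        using y CB stake_in_lists[of y B n] by (auto simp: shift_in_streams_iff sconst_streams)
      moreover have "stake n ?y = stake n y" by (simp add: stake_shift)
      ultimately have "?y \<in> C" using assms(3) y(1) unfolding determined_def by metis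
      moreover have "stake (Suc n) ?y = v"
        using stake_length_shift[of "stake n y @ [b]" "sconst b"] y(3) by simp
      ultimately show "v \<in> stake (Suc n) ` C" by (metis imageI)
    qed
  qed
  moreover have "inj_on (\<lambda>(w, b). w @ [b]) (stake n ` C \<times> B)" by (auto intro!: inj_onI)
  ultimately have "cyl_content q (Suc n) C = (\<Sum>(w, b)\<in>stake n ` C \<times> B. weight q w * q b)"
    unfolding cyl_content_def by (simp add: sum.reindex case_prod_unfold)
  also have "\<dots> = (\<Sum>w\<in>stake n ` C. weight q w * sum q B)"
    by (simp add: sum.cartesian_product[symmetric] sum_distrib_left)
  finally show ?thesis using assms(2) by (simp add: cyl_content_def)
qed

lemma cyl_content_mono:
  assumes "finite B" "sum q B = 1" "determined B n C" "n \<le> m"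
  shows "cyl_content q m C = cyl_content q n C"
  using assms(4)
proof (induct m rule: dec_induct)
  case (step m)
  then show ?case using cyl_content_Suc[OF assms(1,2) determined_mono[OF assms(3), of m]] by simp
qed simp

lemma cyl_content_UN:
  assumes "finite B" "finite I" "\<And>i. i \<in> I \<Longrightarrow> determined B n (C i)"
    and "\<And>i j. i \<in> I \<Longrightarrow> j \<in> I \<Longrightarrow> i \<noteq> j \<Longrightarrow> C i \<inter> C j = {}"
  shows "cyl_content q n (\<Union>i\<in>I. C i) = (\<Sum>i\<in>I. cyl_content q n (C i))"
proof -
  have "stake n ` C i \<inter> stake n ` C j = {}" if "i \<in> I" "j \<in> I" "i \<noteq> j" for i j
    using assms(3)[OF that(1)] assms(3)[OF that(2)] assms(4)[OF that]
    unfolding determined_def by (auto; metis disjoint_iff subsetD)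
  moreover have "finite (stake n ` C i)" if "i \<in> I" for i
    using assms(3)[OF that] finite_stake_image[OF assms(1)] by (simp add: determined_def)
  ultimately show ?thesis
    unfolding cyl_content_def image_UN using assms(2) by (intro sum.UNION_disjoint) auto
qed

lemma cyl_content_shift: "cyl_content q (length w + n) ((@-) w ` C) = weight q w * cyl_content q n C"
proof -
  have "stake (length w + n) ` ((@-) w ` C) = (@) w ` stake n ` C"
    by (auto simp: image_image stake_shift)
  then have "cyl_content q (length w + n) ((@-) w ` C) = (\<Sum>v\<in>(@) w ` stake n ` C. weight q v)"
    by (simp add: cyl_content_def)
  also have "\<dots> = (\<Sum>v\<in>stake n ` C. weight q (w @ v))"
    by (subst sum.reindex) (auto intro: inj_onI)
  finally show ?thesis by (simp add: cyl_content_def sum_distrib_left)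
qed

lemma determined_shift:
  assumes "w \<in> lists B" "determined B n C"
  shows "determined B (length w + n) ((@-) w ` C)"
  unfolding determined_def
proof (intro conjI ballI impI)
  show "(@-) w ` C \<subseteq> streams B"
    using assms by (auto simp: determined_def shift_in_streams_iff)
  fix y y' assume y: "y \<in> (@-) w ` C" "y' \<in> streams B" "stake (length w + n) y = stake (length w + n) y'"
  then obtain z where z: "z \<in> C" "y = w @- z" by blast
  have eq: "w @ stake n z = stake (length w) y' @ stake n (sdrop (length w) y')"
    using y(3) z(2) by (simp add: stake_shift)
  then have "stake (length w) y' = w" "stake n z = stake n (sdrop (length w) y')"
    by (simp_all add: append_eq_append_conv del: stake_add)
  then have "sdrop (length w) y' \<in> C"
    using assms(2) z(1) sdrop_in_streams[OF y(2)] unfolding determined_def by blast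
  then show "y' \<in> (@-) w ` C"
    using stake_length_eqD[OF \<open>stake (length w) y' = w\<close>] by blast
qed

section \<open>Density of images of cylinders\<close>

context sim_bij
begin

text \<open>The image of a cylinder rescaled to unit size.\<close>

definition shape :: "'a list \<Rightarrow> 'b stream set" where
  "shape I = sdrop (length (J I)) ` img I"

lemma img_shape: "I \<in> lists A \<Longrightarrow> img I = (@-) (J I) ` shape I"
proof -
  assume I: "I \<in> lists A"
  have "y = J I @- sdrop (length (J I)) y" if "y \<in> img I" for y
    using J_lcp[OF I] that by (intro stake_length_eqD) blast
  then show ?thesis unfolding shape_def image_image by force
qed

lemma shape_sub: "I \<in> lists A \<Longrightarrow> shape I \<subseteq> streams B"
  using img_sub by (auto simp: shape_def intro!: sdrop_in_streams)

text \<open>One N serves all scales: changing an image point beyond \<open>J I\<close> and N more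
  letters moves it by at most \<open>weight t (J I) * B.rmax ^ N\<close>, which is below the radius
  in \<open>img_open\<close>. One factor L comes from \<open>J_upper\<close>, the other from that
  radius. In particular only finitely many shapes occur.\<close>

lemma shape_determined: "\<exists>N. \<forall>I\<in>lists A. determined B N (shape I)"
proof -
  obtain N where N: "B.rmax ^ N < 1 / (L * L)" using B.rmax_pow_small[of "1 / (L * L)"] L_ge_1 by auto
  have "determined B N (shape I)" if I: "I \<in> lists A" for I
    unfolding determined_def
  proof (intro conjI ballI impI)
    show "shape I \<subseteq> streams B" using shape_sub[OF I] .
    fix y y' assume y: "y \<in> shape I" "y' \<in> streams B" "stake N y = stake N y'"
    have yB: "y \<in> streams B" using y(1) shape_sub[OF I] by blast
    have "J I @- y \<in> img I" using y(1) img_shape[OF I] by simp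
    then obtain x where x: "x \<in> streams A" "J I @- y = f (I @- x)" by (auto simp: img_def)
    have J: "J I @- y' \<in> streams B" using J_in[OF I] y(2) by (simp add: shift_in_streams_iff)
    have "L * sdist t (J I @- y) (J I @- y') = L * (weight t (J I) * sdist t y y')" by simp
    also have "\<dots> \<le> L * ((L * weight r I) * B.rmax ^ N)"
      using L_ge_1 J_upper[OF I] B.sdist_le_pow[OF yB y(3)] B.sdist_nonneg[OF yB] A.weight_pos[OF I]
      by (intro mult_left_mono mult_mono) auto
    also have "\<dots> = weight r I * (L * L * B.rmax ^ N)" by simp
    also have "\<dots> < weight r I"
      using N L_ge_1 A.weight_pos[OF I] by (simp add: field_simps)
    finally obtain x' where "x' \<in> streams A" "J I @- y' = f (I @- x')"
      using img_open[OF I x(1) J] x(2) by metis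
    then have "J I @- y' \<in> img I" by (auto simp: img_def)
    then show "y' \<in> shape I" unfolding shape_def by (intro image_eqI[of _ _ "J I @- y'"]) auto
  qed
  then show ?thesis by blast
qed

lemma img_children:
  assumes I: "I \<in> lists A"
  shows "img I = (\<Union>i\<in>A. img (I @ [i]))" "i \<in> A \<Longrightarrow> j \<in> A \<Longrightarrow> i \<noteq> j \<Longrightarrow> img (I @ [i]) \<inter> img (I @ [j]) = {}"
proof -
  show "img I = (\<Union>i\<in>A. img (I @ [i]))"
  proof
    show "img I \<subseteq> (\<Union>i\<in>A. img (I @ [i]))"
    proof
      fix y assume "y \<in> img I"
      then obtain x where x: "x \<in> streams A" "y = f (I @- x)" by (auto simp: img_def)
      then have "shd x \<in> A" "stl x \<in> streams A" "y = f ((I @ [shd x]) @- stl x)"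
        by (auto elim: streamsE)
      then show "y \<in> (\<Union>i\<in>A. img (I @ [i]))"
        unfolding img_def by blast
    qed
    show "(\<Union>i\<in>A. img (I @ [i])) \<subseteq> img I"
      by (auto simp: img_def)
  qed
  show "img (I @ [i]) \<inter> img (I @ [j]) = {}" if "i \<in> A" "j \<in> A" "i \<noteq> j"
  proof (rule ccontr)
    assume "img (I @ [i]) \<inter> img (I @ [j]) \<noteq> {}"
    then obtain x y where xy: "x \<in> streams A" "y \<in> streams A" "f ((I @ [i]) @- x) = f ((I @ [j]) @- y)"
      unfolding img_def by blast
    then have "(I @ [i]) @- x = (I @ [j]) @- y"
      using f_eq_iff that I by (simp add: shift_in_streams_iff)
    then show False using that(3) by simp
  qed
qed

text \<open>\<phi> compares the measure of the image of a cylinder with the weight of the cylinder.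
  It is an average over the children, is bounded away from 0 and infinity, and changes by one of
  finitely many factors from a word to a child, so \<open>constant_branch\<close> makes it constant
  below some word. There the ratio depends only on the mass of the shape, which takes finitely many
  values.\<close>

lemma finite_ratio_values:
  assumes s: "0 < s" "(\<Sum>j\<in>B. t j powr s) = 1"
  shows "\<exists>I\<in>lists A. finite ((\<lambda>K. weight t (J (I @ K)) / weight r (I @ K)) ` lists A)"
proof -
  \<comment> \<open>The exponent of B is used on both sides; that the \<open>p i\<close> sum to 1
    comes out inside \<open>constant_branch\<close>.\<close>
  define p where "p = (\<lambda>i. r i powr s)"
  define q where "q = (\<lambda>j. t j powr s)"
  have wp: "weight p I = weight r I powr s" "0 < weight p I" if "I \<in> lists A" for I
    unfolding p_def using weight_powr[of A r I s] A.ratio_pos A.weight_pos[OF that] that by auto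
  have wq: "weight q u = weight t u powr s" "0 < weight q u" if "u \<in> lists B" for u
    unfolding q_def using weight_powr[of B t u s] B.ratio_pos B.weight_pos[OF that] that by auto
  have q1: "sum q B = 1" using s(2) by (simp add: q_def)
  obtain N where N: "\<And>I. I \<in> lists A \<Longrightarrow> determined B N (shape I)" using shape_determined by blast
  define m where "m = (\<lambda>I. cyl_content q N (shape I))"
  \<comment> \<open>All masses that a union of cylinders of length N can have; by the choice of N
    every shape is such a union.\<close>
  define Mset where "Mset = (\<lambda>W. \<Sum>w\<in>W. weight q w) ` Pow {w \<in> lists B. length w = N}"
  have finM: "finite Mset" unfolding Mset_def using finite_words[OF B.finite_alphabet] by simp
  have mM: "m I \<in> Mset" if "I \<in> lists A" for I
    unfolding m_def Mset_def cyl_content_def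
    using finite_stake_image(2)[OF B.finite_alphabet shape_sub[OF that]] by blast
  have m_pos: "0 < m I" if I: "I \<in> lists A" for I
    unfolding m_def cyl_content_def
  proof (rule sum_pos)
    note fin = finite_stake_image[OF B.finite_alphabet shape_sub[OF I], of N]
    show "finite (stake N ` shape I)" by (rule fin)
    obtain a where "a \<in> A" by (rule two_letters)
    then show "stake N ` shape I \<noteq> {}"
      by (auto simp: shape_def img_def streams_empty_iff)
    show "0 < weight q w" if "w \<in> stake N ` shape I" for w using fin(2) that wq(2) by blast
  qed
  \<comment> \<open>Bounds for the finitely many positive masses; the inserted 1 spares an argument
    about nonemptiness.\<close>
  define c0 where "c0 = Min (insert 1 {x \<in> Mset. 0 < x})"
  define C0 where "C0 = Max (insert 1 Mset)"
  have c0: "0 < c0" "c0 \<le> m I" if "I \<in> lists A" for I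
    unfolding c0_def using finM mM[OF that] m_pos[OF that] by (simp_all add: Min_le_iff)
  have C0: "m I \<le> C0" if "I \<in> lists A" for I
    unfolding C0_def using finM mM[OF that] by (intro Max_ge) simp_all
  define \<phi> where "\<phi> = (\<lambda>I. weight q (J I) * m I / weight p I)"
  have content: "cyl_content q n (img I) = weight q (J I) * m I" if I: "I \<in> lists A" and n: "length (J I) + N \<le> n" for I n
  proof -
    have "determined B (length (J I) + N) (img I)"
      unfolding img_shape[OF I] by (rule determined_shift[OF J_in[OF I] N[OF I]])
    then have "cyl_content q n (img I) = cyl_content q (length (J I) + N) (img I)"
      by (rule cyl_content_mono[OF B.finite_alphabet q1 _ n])
    also have "\<dots> = weight q (J I) * m I"
      unfolding m_def img_shape[OF I] by (rule cyl_content_shift)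
    finally show ?thesis .
  qed
  have avg: "\<phi> I = (\<Sum>i\<in>A. p i * \<phi> (I @ [i]))" if I: "I \<in> lists A" for I
  proof -
    have Ii: "I @ [i] \<in> lists A" if "i \<in> A" for i using that I by simp
    \<comment> \<open>A level fine enough to resolve the image of I and the images of all its
      children at once.\<close>
    define n where "n = Max (insert (length (J I) + N) ((\<lambda>i. length (J (I @ [i])) + N) ` A))"
    have n: "length (J I) + N \<le> n" "\<And>i. i \<in> A \<Longrightarrow> length (J (I @ [i])) + N \<le> n"
      unfolding n_def using A.finite_alphabet by auto
    have det: "determined B n (img (I @ [i]))" if "i \<in> A" for i
      using determined_mono[OF _ n(2)[OF that]] determined_shift[OF J_in[OF Ii[OF that]] N[OF Ii[OF that]]]
        img_shape[OF Ii[OF that]] by simp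
    have "cyl_content q n (img I) = cyl_content q n (\<Union>i\<in>A. img (I @ [i]))"
      using img_children(1)[OF I] by simp
    also have "\<dots> = (\<Sum>i\<in>A. cyl_content q n (img (I @ [i])))"
      by (rule cyl_content_UN[OF B.finite_alphabet A.finite_alphabet det img_children(2)[OF I]])
    also have "\<dots> = (\<Sum>i\<in>A. weight q (J (I @ [i])) * m (I @ [i]))"
      by (rule sum.cong[OF refl content[OF Ii n(2)]])
    finally have "weight q (J I) * m I = (\<Sum>i\<in>A. weight q (J (I @ [i])) * m (I @ [i]))"
      using content[OF I n(1)] by simp
    then have "\<phi> I = (\<Sum>i\<in>A. weight q (J (I @ [i])) * m (I @ [i])) / weight p I"
      by (simp add: \<phi>_def)
    also have "\<dots> = (\<Sum>i\<in>A. p i * \<phi> (I @ [i]))"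
      unfolding sum_divide_distrib \<phi>_def
    proof (rule sum.cong)
      fix i assume i: "i \<in> A"
      have "0 < p i" using A.ratio_pos[OF i] by (simp add: p_def)
      then show "weight q (J (I @ [i])) * m (I @ [i]) / weight p I
          = p i * (weight q (J (I @ [i])) * m (I @ [i]) / weight p (I @ [i]))"
        by (simp add: field_simps)
    qed simp
    finally show ?thesis .
  qed
  have ratio_bounds: "(1 / L) powr s \<le> weight q (J I) / weight p I" "weight q (J I) / weight p I \<le> L powr s"
    if I: "I \<in> lists A" for I
  proof -
    have eq: "weight q (J I) / weight p I = (weight t (J I) / weight r I) powr s"
      using wp[OF I] wq[OF J_in[OF I]] A.weight_pos[OF I] B.weight_pos[OF J_in[OF I]] by (simp add: powr_divide)
    have "1 / L \<le> weight t (J I) / weight r I" "weight t (J I) / weight r I \<le> L"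
      using J_lower[OF I] J_upper[OF I] A.weight_pos[OF I] L_ge_1 by (simp_all add: field_simps)
    then show "(1 / L) powr s \<le> weight q (J I) / weight p I" "weight q (J I) / weight p I \<le> L powr s"
      unfolding eq using s(1) L_ge_1 A.weight_pos[OF I] B.weight_pos[OF J_in[OF I]]
      by (simp_all add: powr_mono2)
  qed
  have bounds: "(1 / L) powr s * c0 \<le> \<phi> I \<and> \<phi> I \<le> L powr s * C0" if I: "I \<in> lists A" for I
  proof -
    have "\<phi> I = weight q (J I) / weight p I * m I" by (simp add: \<phi>_def)
    then show ?thesis
      using mult_mono[OF ratio_bounds(1)[OF I] c0(2)[OF I]] mult_mono[OF ratio_bounds(2)[OF I] C0[OF I]]
        wp(2)[OF I] wq(2)[OF J_in[OF I]] c0(1)[OF I] m_pos[OF I] L_ge_1 by simp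
  qed
  \<comment> \<open>A child adds at most N1 target letters: \<open>J_lower\<close> for the child and
    \<open>J_upper\<close> for I give \<open>r i \<le> L * L * B.rmax ^ length u\<close>.\<close>
  obtain N1 where N1: "B.rmax ^ N1 < A.rmin / (L * L)"
    using B.rmax_pow_small[of "A.rmin / (L * L)"] L_ge_1 A.rmin_pos by auto
  define \<Psi> where "\<Psi> = (\<lambda>(u, m1, m2, i). weight q u * m1 / (m2 * p i)) ` ({u \<in> lists B. length u \<le> N1} \<times> Mset \<times> Mset \<times> A)"
  have fin\<Psi>: "finite \<Psi>"
    unfolding \<Psi>_def using finite_words_le[OF B.finite_alphabet] finM A.finite_alphabet by simp
  have in\<Psi>: "\<phi> (I @ [i]) / \<phi> I \<in> \<Psi>" if I: "I \<in> lists A" and i: "i \<in> A" for I i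
  proof -
    have Ii: "I @ [i] \<in> lists A" using I i by simp
    obtain u where u: "u \<in> lists B" "J (I @ [i]) = J I @ u" using J_append[OF I, of "[i]"] i by auto
    have "weight r (I @ [i]) \<le> L * weight t (J (I @ [i]))" by (rule J_lower[OF Ii])
    also have "\<dots> = L * (weight t (J I) * weight t u)" using u(2) by simp
    also have "\<dots> \<le> L * ((L * weight r I) * B.rmax ^ length u)"
      using J_upper[OF I] B.weight_le_pow[OF u(1)] L_ge_1 B.weight_pos[OF u(1)] B.weight_pos[OF J_in[OF I]] A.weight_pos[OF I]
      by (intro mult_left_mono mult_mono) auto
    finally have "r i \<le> L * L * B.rmax ^ length u" using A.weight_pos[OF I] by simp
    then have "A.rmin / (L * L) \<le> B.rmax ^ length u"
      using A.rmin_le[OF i] L_ge_1 by (simp add: field_simps)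
    then have "length u \<le> N1"
      using N1 B.rmax_pow_mono[of N1 "length u"] by (cases "length u \<le> N1") auto
    moreover have "\<phi> (I @ [i]) / \<phi> I = weight q u * m (I @ [i]) / (m I * p i)"
      using u(2) wq(2)[OF J_in[OF I]] wp(2)[OF I] by (simp add: \<phi>_def)
    ultimately show ?thesis
      unfolding \<Psi>_def using u(1) mM[OF I] mM[OF Ii] i
      by (intro image_eqI[of _ _ "(u, m (I @ [i]), m I, i)"]) auto
  qed
  have "0 < p i" if "i \<in> A" for i using A.ratio_pos[OF that] by (simp add: p_def)
  then have "\<exists>I\<in>lists A. \<forall>K\<in>lists A. \<phi> (I @ K) = \<phi> I"
    by (rule constant_branch[OF A.finite_alphabet _ avg bounds _ fin\<Psi> in\<Psi>]) (use L_ge_1 c0(1)[of "[]"] in simp_all)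
  then obtain I where I: "I \<in> lists A" "\<forall>K\<in>lists A. \<phi> (I @ K) = \<phi> I" by blast
  \<comment> \<open>With \<phi> constant, the s-th power of the ratio is that constant divided by
    the mass of the shape.\<close>
  have "(\<lambda>K. weight t (J (I @ K)) / weight r (I @ K)) ` lists A \<subseteq> (\<lambda>x. (\<phi> I / x) powr (1 / s)) ` Mset"
  proof
    fix v assume "v \<in> (\<lambda>K. weight t (J (I @ K)) / weight r (I @ K)) ` lists A"
    then obtain K where K: "K \<in> lists A" "v = weight t (J (I @ K)) / weight r (I @ K)" by blast
    then have IK: "I @ K \<in> lists A" using I by simp
    have v: "0 < v" using K(2) A.weight_pos[OF IK] B.weight_pos[OF J_in[OF IK]] by simp
    have "v powr s = \<phi> (I @ K) / m (I @ K)"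
      using wp[OF IK] wq[OF J_in[OF IK]] A.weight_pos[OF IK] B.weight_pos[OF J_in[OF IK]] m_pos[OF IK] K(2)
      by (simp add: \<phi>_def powr_divide)
    moreover have "v = (v powr s) powr (1 / s)" using v s(1) by (simp add: powr_powr)
    ultimately have "v = (\<phi> I / m (I @ K)) powr (1 / s)" using I(2) K(1) by simp
    then show "v \<in> (\<lambda>x. (\<phi> I / x) powr (1 / s)) ` Mset" using mM[OF IK] by blast
  qed
  then show ?thesis using I(1) finM finite_surj by blast
qed

text \<open>Let I extend the word of \<open>finite_ratio_values\<close> so that the ratios of target weight to source weight,
  taken over extensions K of I with weight in G or K empty, form a set of least cardinality. Every K can then be
  extended until the ratio at I recurs, and at that moment the added target word has weight in G.\<close>

lemma stable_word:
  assumes A': "A' \<subseteq> A"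
    and G: "\<And>a b. a \<in> G \<Longrightarrow> b \<in> G \<Longrightarrow> a * b \<in> G"
    and G1: "\<And>I. I \<in> lists A' \<Longrightarrow> \<exists>K\<in>lists A'. weight r (I @ K) \<in> G"
    and G2: "\<And>u. u \<in> lists B \<Longrightarrow> weight t u \<in> G \<Longrightarrow> u \<in> lists B'"
  shows "\<exists>I\<in>lists A. \<forall>K\<in>lists A'. \<exists>u\<in>lists B'. J (I @ K) = J I @ u"
proof -
  have A'A: "K \<in> lists A" if "K \<in> lists A'" for K using that A' by auto
  obtain s where s: "0 \<le> s" "(\<Sum>j\<in>B. t j powr s) = 1"
    using dimension_exists[OF B.alphabet_axioms] two_B by fastforce
  \<comment> \<open>At the exponent 0 the sum counts the letters of B, of which there are at least
    two.\<close>
  have "s \<noteq> 0"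
  proof
    assume "s = 0"
    then have "(\<Sum>j\<in>B. t j powr s) = (\<Sum>j\<in>B. 1)" by (intro sum.cong) (use B.ratio_pos in force)+
    then show False using s two_B by simp
  qed
  then obtain I1 where I1: "I1 \<in> lists A" "finite ((\<lambda>K. weight t (J (I1 @ K)) / weight r (I1 @ K)) ` lists A)"
    using finite_ratio_values[of s] s by auto
  define v where "v = (\<lambda>I. weight t (J I) / weight r I)"
  \<comment> \<open>Weight 1 admits the empty word and keeps H closed under concatenation.\<close>
  define H where "H = {K \<in> lists A'. weight r K \<in> insert 1 G}"
  define V where "V = (\<lambda>I. (\<lambda>K. v (I @ K)) ` H)"
  have H_append: "K @ K' \<in> H" if "K \<in> H" "K' \<in> H" for K K' using that G by (auto simp: H_def)
  have finV: "finite (V (I1 @ K))" if "K \<in> H" for K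
  proof (rule finite_subset)
    show "V (I1 @ K) \<subseteq> (\<lambda>K. weight t (J (I1 @ K)) / weight r (I1 @ K)) ` lists A"
    proof
      fix y assume "y \<in> V (I1 @ K)"
      then obtain K' where K': "K' \<in> H" "y = v (I1 @ (K @ K'))" by (auto simp: V_def)
      then have "K @ K' \<in> lists A" using that A'A[of K] A'A[of K'] by (simp add: H_def)
      then show "y \<in> (\<lambda>K. weight t (J (I1 @ K)) / weight r (I1 @ K)) ` lists A"
        using K'(2) unfolding v_def by blast
    qed
  qed (rule I1(2))
  have nilH: "[] \<in> H" by (simp add: H_def)
  obtain K0 where K0: "K0 \<in> H" "\<And>K. K \<in> H \<Longrightarrow> card (V (I1 @ K0)) \<le> card (V (I1 @ K))"
    using ex_has_least_nat[of "\<lambda>K. K \<in> H", OF nilH, of "\<lambda>K. card (V (I1 @ K))"] by auto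
  let ?I = "I1 @ K0"
  have I: "?I \<in> lists A" using I1(1) K0(1) A'A by (simp add: H_def)
  have "\<exists>u\<in>lists B'. J (?I @ K) = J ?I @ u" if K: "K \<in> lists A'" for K
  proof -
    obtain K1 where K1: "K1 \<in> lists A'" "weight r (K @ K1) \<in> G" using G1[OF K] by blast
    have KK1: "K @ K1 \<in> H" using K K1 by (simp add: H_def)
    \<comment> \<open>Since \<open>K @ K1\<close> is in H, the longer word still competes for the
      least cardinality, and the inclusion becomes an equality. So the ratio at \<open>?I\<close>
      recurs below every such extension.\<close>
    have "V (?I @ K @ K1) \<subseteq> V ?I"
    proof
      fix y assume "y \<in> V (?I @ K @ K1)"
      then obtain K' where "K' \<in> H" "y = v (?I @ ((K @ K1) @ K'))" by (auto simp: V_def)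
      then show "y \<in> V ?I" using H_append[OF KK1] unfolding V_def by blast
    qed
    then have "V (?I @ K @ K1) = V ?I"
      using K0(2)[OF H_append[OF K0(1) KK1]] finV[OF K0(1)] by (intro card_seteq) simp_all
    moreover have "v ?I \<in> V ?I" unfolding V_def using nilH by (rule image_eqI[rotated]) simp
    ultimately have "v ?I \<in> V (?I @ K @ K1)" by simp
    then obtain K2 where K2: "K2 \<in> H" "v ?I = v ((?I @ K @ K1) @ K2)" unfolding V_def by auto
    let ?K = "K @ K1 @ K2"
    have Kin: "?K \<in> lists A" "K \<in> lists A" "K1 @ K2 \<in> lists A" using K K1 K2 A'A by (auto simp: H_def)
    have IK: "?I @ K \<in> lists A" using I Kin by simp
    obtain u where u: "u \<in> lists B" "J (?I @ ?K) = J ?I @ u" using J_append[OF I Kin(1)] by blast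
    have "weight t (J ?I) * weight t u / (weight r ?I * weight r ?K) = weight t (J ?I) / weight r ?I"
      using K2(2) u(2) by (simp add: v_def)
    moreover have "x = k" if "a * x / (b * k) = a / b" "0 < a" "0 < b" "0 < k" for a b k x :: real
      using that by (simp add: field_simps)
    ultimately have "weight t u = weight r ?K"
      using A.weight_pos[OF I] B.weight_pos[OF J_in[OF I]] A.weight_pos[OF Kin(1)] by blast
    \<comment> \<open>The factor from \<open>K @ K1\<close> is in G, so the product is in G even if
      K2 is empty.\<close>
    then have "weight t u = weight r (K @ K1) * weight r K2" by (simp add: mult.assoc)
    then have "weight t u \<in> G" using K1(2) K2(1) G by (auto simp: H_def)
    then have uB: "u \<in> lists B'" using G2[OF u(1)] by blast
    \<comment> \<open>What K alone adds to \<open>J ?I\<close> is a prefix of u, hence also a word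
      over B'.\<close>
    obtain u1 where u1: "J (?I @ K) = J ?I @ u1" using J_append[OF I Kin(2)] by blast
    obtain u2 where "J ((?I @ K) @ K1 @ K2) = J (?I @ K) @ u2" using J_append[OF IK Kin(3)] by blast
    then have "u = u1 @ u2" using u(2) u1 by simp
    then show ?thesis using uB u1 by auto
  qed
  then show ?thesis using I by blast
qed

end

section \<open>Counting, and blowing up the inverse map\<close>

lemma sum_weight_words:
  fixes q :: "'b \<Rightarrow> real"
  assumes "finite B"
  shows "(\<Sum>w\<in>{w \<in> lists B. length w = n}. weight q w) = sum q B ^ n"
proof (induct n)
  case 0
  have "{w \<in> lists B. length w = 0} = {[]}" by auto
  then show ?case by simp
next
  case (Suc n)
  have eq: "{w \<in> lists B. length w = Suc n} = (\<lambda>(b, w). b # w) ` (B \<times> {w \<in> lists B. length w = n})"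
    by (force simp: length_Suc_conv)
  let ?W = "{w \<in> lists B. length w = n}"
  have "inj_on (\<lambda>(b, w). b # w) (B \<times> ?W)" by (auto intro!: inj_onI)
  then have "(\<Sum>w\<in>{w \<in> lists B. length w = Suc n}. weight q w) = (\<Sum>(b, w)\<in>B \<times> ?W. q b * weight q w)"
    unfolding eq by (simp add: sum.reindex case_prod_unfold)
  also have "\<dots> = (\<Sum>b\<in>B. \<Sum>w\<in>?W. q b * weight q w)"
    by (rule sum.cartesian_product[symmetric])
  also have "\<dots> = sum q B * (\<Sum>w\<in>?W. weight q w)"
    by (rule sum_product[symmetric])
  finally show ?case using Suc by simp
qed

locale stable = sim_bij +
  fixes A' B' I
  assumes A'_sub: "A' \<subseteq> A" and B'_sub: "B' \<subseteq> B" and I_in: "I \<in> lists A"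
    and stable: "K \<in> lists A' \<Longrightarrow> \<exists>u\<in>lists B'. J (I @ K) = J I @ u"
begin

definition F :: "'a stream \<Rightarrow> 'b stream" where
  "F x = sdrop (length (J I)) (f (I @- x))"

lemma A'_streams: "x \<in> streams A' \<Longrightarrow> x \<in> streams A"
  by (rule streams_mono[OF _ A'_sub])

lemma B'_streams: "y \<in> streams B' \<Longrightarrow> y \<in> streams B"
  by (rule streams_mono[OF _ B'_sub])

lemma A'_lists: "w \<in> lists A' \<Longrightarrow> w \<in> lists A"
  using A'_sub by auto

lemma B'_lists: "w \<in> lists B' \<Longrightarrow> w \<in> lists B"
  using B'_sub by auto

lemma f_eq_F: "x \<in> streams A' \<Longrightarrow> f (I @- x) = J I @- F x"
  unfolding F_def by (rule stake_length_eqD[OF J_prefix[OF I_in A'_streams]])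

text \<open>The letters of \<open>F x\<close> are those that J gains along the prefixes of x, and
  stability places them in B'. J becomes arbitrarily long, its weight being at most L times a weight
  that tends to 0.\<close>

lemma F_in:
  assumes x: "x \<in> streams A'"
  shows "F x \<in> streams B'"
  unfolding streams_iff_snth
proof
  fix n
  define l where "l = length (J I) + Suc n"
  obtain k where k: "A.rmax ^ k < B.rmin ^ l / L"
    using A.rmax_pow_small[of "B.rmin ^ l / L"] B.rmin_pos L_ge_1 by auto
  have st: "stake k x \<in> lists A'" "stake k x \<in> lists A"
    using stake_in_lists[OF x] stake_in_lists[OF A'_streams[OF x]] by blast+
  let ?I = "I @ stake k x"
  have I: "?I \<in> lists A" using I_in st by simp
  obtain u where u: "u \<in> lists B'" "J ?I = J I @ u" using stable[OF st(1)] by blast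
  have "B.rmin ^ length (J ?I) \<le> weight t (J ?I)" by (rule B.weight_ge_pow[OF J_in[OF I]])
  also have "\<dots> \<le> L * (weight r I * weight r (stake k x))" using J_upper[OF I] by simp
  also have "\<dots> \<le> L * (1 * A.rmax ^ k)"
    using A.weight_le_1[OF I_in] A.weight_le_pow[OF st(2)] L_ge_1 A.weight_pos[OF I_in] A.weight_pos[OF st(2)]
    by (intro mult_left_mono mult_mono) auto
  also have "\<dots> < B.rmin ^ l" using k L_ge_1 by (simp add: field_simps)
  finally have "l < length (J ?I)"
    using B.rmin_pos B.rmin_less_1 power_decreasing[of "length (J ?I)" l B.rmin]
    by (cases "l < length (J ?I)") auto
  then have n: "n < length u" using u(2) by (simp add: l_def)
  have "stake (length (J I @ u)) (J I @- F x) = J I @ u"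
    using J_prefix[OF I sdrop_in_streams[OF A'_streams[OF x]], of k] u(2) f_eq_F[OF x]
    by (simp add: stake_sdrop del: stake_add)
  then have "stake (length u) (F x) = u" by (simp add: stake_shift)
  then have "F x !! n = u ! n" using n stake_nth by metis
  then show "F x !! n \<in> B'" using u(1) n by auto
qed

definition hit :: "'b list \<Rightarrow> bool" where
  "hit v \<longleftrightarrow> (\<exists>x\<in>streams A'. stake (length v) (F x) = v)"

text \<open>The preimage of the cylinder of v has diameter of the order of the weight of v, and so
  lies in a single cylinder of comparable weight.\<close>

lemma hit_preimage:
  assumes v: "v \<in> lists B'" "hit v"
  shows "\<exists>u\<in>lists A'. weight r u \<le> L * weight t (J I) / (weight r I * A.rmin) * weight t v
    \<and> (\<forall>x\<in>streams A'. stake (length v) (F x) = v \<longrightarrow> stake (length u) x = u)"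
proof -
  define \<theta> where "\<theta> = L * weight t (J I) * weight t v / weight r I"
  have pos: "0 < weight r I" "0 < weight t (J I)" "0 < weight t v"
    using A.weight_pos[OF I_in] B.weight_pos[OF J_in[OF I_in]] B.weight_pos[OF B'_lists[OF v(1)]] by auto
  have \<theta>: "0 < \<theta>" using pos L_ge_1 by (simp add: \<theta>_def)
  obtain x0 where x0: "x0 \<in> streams A'" "stake (length v) (F x0) = v" using v(2) by (auto simp: hit_def)
  have close: "sdist r x0 x \<le> \<theta>" if x: "x \<in> streams A'" "stake (length v) (F x) = v" for x
  proof -
    have "I @- x0 \<in> streams A" "I @- x \<in> streams A"
      using I_in A'_streams[OF x0(1)] A'_streams[OF x(1)] by (auto simp: shift_in_streams_iff)
    then have "weight r I * sdist r x0 x \<le> L * (weight t (J I) * sdist t (F x0) (F x))"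
      using lower[of "I @- x0" "I @- x"] f_eq_F[OF x0(1)] f_eq_F[OF x(1)] by simp
    also have "\<dots> \<le> L * (weight t (J I) * weight t v)"
      using B.sdist_le[OF B'_streams[OF F_in[OF x0(1)]], of "length v" "F x"] x0(2) x(2) pos L_ge_1
      by (intro mult_left_mono) auto
    finally show ?thesis using pos by (simp add: \<theta>_def field_simps)
  qed
  \<comment> \<open>The prefix u is the first one with weight at most \<theta> / rmin. Its parent,
    if any, has larger weight, so u itself has weight above \<theta>, and streams within distance
    \<theta> of x0 share it.\<close>
  define P where "P = (\<lambda>n. weight r (stake n x0) \<le> \<theta> / A.rmin)"
  obtain k where "A.rmax ^ k < \<theta> / A.rmin" using A.rmax_pow_small[of "\<theta> / A.rmin"] \<theta> A.rmin_pos by auto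
  then have "P k" using A.weight_le_pow[OF stake_in_lists[OF A'_streams[OF x0(1)]], of k] by (simp add: P_def)
  define n where "n = (LEAST n. P n)"
  have n: "P n" unfolding n_def using \<open>P k\<close> by (rule LeastI)
  have "stake n x = stake n x0" if x: "x \<in> streams A'" "stake (length v) (F x) = v" for x
  proof (cases n)
    case (Suc m)
    then have "\<not> P m" using not_less_Least[of m P] by (simp add: n_def)
    then have "\<theta> < weight r (stake m x0) * A.rmin" using A.rmin_pos by (simp add: P_def field_simps)
    also have "\<dots> \<le> weight r (stake m x0) * r (x0 !! m)"
      using A.rmin_le[OF snth_in[OF A'_streams[OF x0(1)]]] A.weight_stake_pos[OF A'_streams[OF x0(1)], of m]
      by (intro mult_left_mono) auto
    also have "\<dots> = weight r (stake n x0)" by (simp add: Suc stake_Suc del: stake.simps(2))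
    finally have "sdist r x0 x < weight r (stake n x0)" using close[OF x] by simp
    then show ?thesis using A.sdist_greater[OF A'_streams[OF x0(1)], of n x] by force
  qed simp
  moreover have "weight r (stake n x0) \<le> L * weight t (J I) / (weight r I * A.rmin) * weight t v"
    using n pos A.rmin_pos by (simp add: P_def \<theta>_def field_simps)
  ultimately show ?thesis using stake_in_lists[OF x0(1), of n] by (intro bexI[of _ "stake n x0"]) auto
qed

text \<open>If every word missed one of its extensions by N letters, the words of length k * N that are hit would carry
  total s-weight decaying geometrically in k, although their preimages cover \<open>streams A'\<close>.\<close>

lemma all_extensions_hit:
  assumes s: "0 \<le> s" "1 \<le> (\<Sum>i\<in>A'. r i powr s)" "(\<Sum>j\<in>B'. t j powr s) \<le> 1"
  shows "\<exists>v\<in>lists B'. \<forall>w\<in>lists B'. length w = N \<longrightarrow> hit (v @ w)"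
proof (rule ccontr)
  assume contra: "\<not> ?thesis"
  define missed where "missed = (\<lambda>v. SOME w. w \<in> lists B' \<and> length w = N \<and> \<not> hit (v @ w))"
  have missed: "missed v \<in> lists B' \<and> length (missed v) = N \<and> \<not> hit (v @ missed v)" if "v \<in> lists B'" for v
  proof -
    have "\<exists>w. w \<in> lists B' \<and> length w = N \<and> \<not> hit (v @ w)" using contra that by auto
    then show ?thesis unfolding missed_def by (rule someI_ex)
  qed
  define p where "p = (\<lambda>i. r i powr s)"
  define q where "q = (\<lambda>j. t j powr s)"
  have wp: "weight p u = weight r u powr s" if "u \<in> lists A'" for u
    unfolding p_def using weight_powr[of A r u s] A.ratio_pos A'_lists[OF that] by auto
  have wq: "weight q u = weight t u powr s" "0 < weight q u" if "u \<in> lists B'" for u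
    unfolding q_def using weight_powr[of B t u s] B.ratio_pos B.weight_pos[OF B'_lists[OF that]] B'_lists[OF that] by auto
  have finB': "finite B'" using B'_sub B.finite_alphabet finite_subset by blast
  define words where "words = {w \<in> lists B'. length w = N}"
  have fin_words: "finite words" unfolding words_def by (rule finite_words[OF finB'])
  have q_nonneg: "0 \<le> sum q B'" unfolding q_def by (intro sum_nonneg) simp
  have sum_words: "(\<Sum>w\<in>words. weight q w) \<le> 1"
    unfolding words_def sum_weight_words[OF finB'] using s(3) q_nonneg by (simp add: q_def power_le_one)
  \<comment> \<open>A lower bound for the s-weight of a word of length N, hence for the share lost
    with each missed extension. It equals 1 when s = 0.\<close>
  define \<delta> where "\<delta> = (B.rmin ^ N) powr s"
  have \<delta>: "0 < \<delta>" using B.rmin_pos by (simp add: \<delta>_def)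
  have \<delta>_le: "\<delta> \<le> weight q w" if "w \<in> words" for w
    unfolding \<delta>_def using that B.weight_ge_pow[OF B'_lists, of w] B.rmin_pos s(1)
    by (subst wq(1)) (auto simp: words_def intro!: powr_mono2)
  have "\<delta> \<le> 1" using B.rmin_pos B.rmin_less_1 s(1) powr_mono2[of s "B.rmin ^ N" 1]
    by (simp add: \<delta>_def power_le_one)
  define W where "W = (\<lambda>k. {v \<in> lists B'. length v = k * N \<and> hit v})"
  have finW: "finite (W k)" for k
    using finite_words[OF finB', of "k * N"] by (rule rev_finite_subset) (auto simp: W_def)
  \<comment> \<open>Without its last N letters a hit word is still hit, and those N letters cannot
    be the missed extension.\<close>
  have step: "W (Suc k) \<subseteq> (\<lambda>(v, w). v @ w) ` (SIGMA v:W k. words - {missed v})" for k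
  proof
    fix z assume z: "z \<in> W (Suc k)"
    then have zB: "z \<in> lists B'" "length z = k * N + N" "hit z" by (auto simp: W_def)
    let ?v = "take (k * N) z" and ?w = "drop (k * N) z"
    have vw: "?v \<in> lists B'" "?w \<in> lists B'" "z = ?v @ ?w"
      using zB(1) by (auto dest: in_set_takeD in_set_dropD)
    obtain x where x: "x \<in> streams A'" "stake (length z) (F x) = z" using zB(3) by (auto simp: hit_def)
    then have "take (k * N) (stake (length z) (F x)) = ?v" by simp
    then have "stake (length ?v) (F x) = ?v" using zB(2) by (simp add: take_stake)
    then have "?v \<in> W k" using x(1) vw zB(2) by (auto simp: W_def hit_def)
    moreover have "?w \<noteq> missed ?v" using missed[OF vw(1)] zB(3) vw(3) by metis
    ultimately show "z \<in> (\<lambda>(v, w). v @ w) ` (SIGMA v:W k. words - {missed v})"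
      using vw zB(2) by (intro image_eqI[of _ _ "(?v, ?w)"]) (auto simp: words_def)
  qed
  have W_sum: "(\<Sum>v\<in>W k. weight q v) \<le> (1 - \<delta>) ^ k" for k
  proof (induct k)
    case 0
    have "W 0 \<subseteq> {[]}" by (auto simp: W_def)
    then have "(\<Sum>v\<in>W 0. weight q v) \<le> (\<Sum>v\<in>{[]}. weight q v)" by (intro sum_mono2) auto
    then show ?case by simp
  next
    case (Suc k)
    have WB: "v \<in> lists B'" if "v \<in> W k" for v using that by (simp add: W_def)
    have nonneg: "0 \<le> weight q (v @ w)" if "v \<in> W k" "w \<in> words" for v w
      using wq(2)[OF WB[OF that(1)]] wq(2)[of w] that(2) by (simp add: words_def)
    have finS: "finite (SIGMA v:W k. words - {missed v})" using finW fin_words by auto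
    have "(\<Sum>v\<in>W (Suc k). weight q v) \<le> (\<Sum>v\<in>(\<lambda>(v, w). v @ w) ` (SIGMA v:W k. words - {missed v}). weight q v)"
      using finS nonneg by (intro sum_mono2 step) auto
    also have "\<dots> \<le> (\<Sum>(v, w)\<in>(SIGMA v:W k. words - {missed v}). weight q (v @ w))"
      using sum_image_le[OF finS, of "weight q" "\<lambda>(v, w). v @ w"] nonneg by (auto simp: case_prod_unfold)
    also have "\<dots> = (\<Sum>v\<in>W k. weight q v * (\<Sum>w\<in>words - {missed v}. weight q w))"
      using finW fin_words by (subst sum.Sigma[symmetric]) (auto simp: sum_distrib_left)
    also have "\<dots> \<le> (\<Sum>v\<in>W k. weight q v * (1 - \<delta>))"
    proof (intro sum_mono mult_left_mono)
      fix v assume v: "v \<in> W k"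
      have m: "missed v \<in> words" using missed[OF WB[OF v]] by (simp add: words_def)
      have "(\<Sum>w\<in>words - {missed v}. weight q w) = (\<Sum>w\<in>words. weight q w) - weight q (missed v)"
        using fin_words m by (simp add: sum_diff1)
      then show "(\<Sum>w\<in>words - {missed v}. weight q w) \<le> 1 - \<delta>"
        using sum_words \<delta>_le[OF m] by simp
      show "0 \<le> weight q v" using wq(2)[OF WB[OF v]] by simp
    qed
    also have "\<dots> \<le> (1 - \<delta>) ^ k * (1 - \<delta>)"
      unfolding sum_distrib_right[symmetric] using Suc \<open>\<delta> \<le> 1\<close> by (intro mult_right_mono) auto
    finally show ?case by (simp add: mult.commute)
  qed
  define C where "C = L * weight t (J I) / (weight r I * A.rmin)"
  have C: "0 < C" using L_ge_1 A.rmin_pos A.weight_pos[OF I_in] B.weight_pos[OF J_in[OF I_in]] by (simp add: C_def)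
  \<comment> \<open>The words from \<open>hit_preimage\<close> cover \<open>streams A'\<close>, so
    their s-weights add up to at least 1, while each is at most \<open>C powr s\<close> times the
    s-weight of its hit word.\<close>
  have "1 \<le> C powr s * (1 - \<delta>) ^ k" for k
  proof -
    have "\<forall>v\<in>W k. \<exists>u. u \<in> lists A' \<and> weight r u \<le> C * weight t v
      \<and> (\<forall>x\<in>streams A'. stake (length v) (F x) = v \<longrightarrow> stake (length u) x = u)"
    proof
      fix v assume "v \<in> W k"
      then show "\<exists>u. u \<in> lists A' \<and> weight r u \<le> C * weight t v
        \<and> (\<forall>x\<in>streams A'. stake (length v) (F x) = v \<longrightarrow> stake (length u) x = u)"
        using hit_preimage[of v] unfolding C_def W_def by blast
    qed
    then obtain u where u: "\<forall>v\<in>W k. u v \<in> lists A' \<and> weight r (u v) \<le> C * weight t v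
      \<and> (\<forall>x\<in>streams A'. stake (length v) (F x) = v \<longrightarrow> stake (length (u v)) x = u v)"
      by (rule bchoice[THEN exE])
    have "1 \<le> (\<Sum>u\<in>u ` W k. weight p u)"
    proof (rule cover_weight_ge_1)
      show "0 \<le> p i" for i by (simp add: p_def)
      show "1 \<le> sum p A'" using s(2) by (simp add: p_def)
      show "finite (u ` W k)" using finW by simp
      show "u ` W k \<subseteq> lists A'" using u by blast
      fix x assume x: "x \<in> streams A'"
      define v where "v = stake (k * N) (F x)"
      have v: "v \<in> W k" "stake (length v) (F x) = v"
        using x stake_in_lists[OF F_in[OF x], of "k * N"] by (auto simp: W_def hit_def v_def)
      then have "stake (length (u v)) x = u v" using u x by blast
      with v(1) show "\<exists>z\<in>u ` W k. stake (length z) x = z" by blast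
    qed
    also have "\<dots> \<le> (\<Sum>v\<in>W k. weight p (u v))"
    proof -
      have "0 \<le> weight p (u v)" if "v \<in> W k" for v using u that wp[of "u v"] by simp
      then show ?thesis using sum_image_le[OF finW, of k "weight p" u] by simp
    qed
    also have "\<dots> \<le> (\<Sum>v\<in>W k. C powr s * weight q v)"
    proof (rule sum_mono)
      fix v assume v: "v \<in> W k"
      then have vB: "v \<in> lists B'" and uA: "u v \<in> lists A'" and le: "weight r (u v) \<le> C * weight t v"
        using u by (auto simp: W_def)
      have "weight r (u v) powr s \<le> (C * weight t v) powr s"
        using le A.weight_pos[OF A'_lists[OF uA]] s(1) by (intro powr_mono2) auto
      then show "weight p (u v) \<le> C powr s * weight q v"
        using wp[OF uA] wq(1)[OF vB] C B.weight_pos[OF B'_lists[OF vB]] by (simp add: powr_mult)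
    qed
    also have "\<dots> \<le> C powr s * (1 - \<delta>) ^ k"
      unfolding sum_distrib_left[symmetric] using W_sum by (intro mult_left_mono) auto
    finally show ?thesis .
  qed
  moreover obtain k where "(1 - \<delta>) ^ k < 1 / C powr s"
    using real_arch_pow_inv[of "1 / C powr s" "1 - \<delta>"] C \<delta> by auto
  ultimately show False using C by (simp add: field_simps not_le[symmetric])
qed

text \<open>Copies of a fixed letter b make v light. Requiring all extensions by M + N letters to be
  hit leaves N letters free after the M copies.\<close>

lemma small_extensions_hit:
  assumes "0 \<le> s" "1 \<le> (\<Sum>i\<in>A'. r i powr s)" "(\<Sum>j\<in>B'. t j powr s) \<le> 1" and e: "0 < e"
  shows "\<exists>v\<in>lists B'. weight t v < e \<and> (\<forall>w\<in>lists B'. length w = N \<longrightarrow> hit (v @ w))"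
proof -
  have "A' \<noteq> {}" using assms(2) by auto
  then obtain a where "sconst a \<in> streams A'" using sconst_streams by (metis ex_in_conv)
  then obtain b where b: "b \<in> B'" using F_in snth_in by metis
  obtain M where M: "B.rmax ^ M < e" using B.rmax_pow_small[OF e] by blast
  obtain v where v: "v \<in> lists B'" "\<And>w. w \<in> lists B' \<Longrightarrow> length w = M + N \<Longrightarrow> hit (v @ w)"
    using all_extensions_hit[OF assms(1-3), of "M + N"] by blast
  let ?v = "v @ replicate M b"
  have vB: "?v \<in> lists B'" "replicate M b \<in> lists B'" using v(1) b by auto
  have "weight t ?v \<le> 1 * B.rmax ^ M"
    using B.weight_le_1[OF B'_lists[OF v(1)]] B.weight_le_pow[OF B'_lists[OF vB(2)]]
      B.weight_pos[OF B'_lists[OF v(1)]] B.weight_pos[OF B'_lists[OF vB(2)]]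
    by (simp only: weight_simps length_replicate, intro mult_mono) auto
  then have "weight t ?v < e" using M by simp
  moreover have "hit (?v @ w)" if "w \<in> lists B'" "length w = N" for w
    using v(2)[of "replicate M b @ w"] that vB(2) by simp
  ultimately show ?thesis using vB(1) by blast
qed

text \<open>G is the inverse of f near a long target word all of whose extensions by n letters are hit, rescaled to unit size.\<close>

lemma blowup:
  assumes s: "0 \<le> s" "1 \<le> (\<Sum>i\<in>A'. r i powr s)" "(\<Sum>j\<in>B'. t j powr s) \<le> 1"
  shows "\<exists>G. (\<forall>y\<in>streams B. G y \<in> streams A)
    \<and> (\<forall>y\<in>streams B. \<forall>z\<in>streams B. sdist t y z \<le> L * L * sdist r (G y) (G z) \<and> sdist r (G y) (G z) \<le> L * L * sdist t y z)
    \<and> (\<forall>y\<in>streams B'. \<forall>x\<in>streams A'. L * L * sdist r (G y) x < 1 \<longrightarrow> (\<exists>z\<in>streams B'. G z = x))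
    \<and> (\<forall>y\<in>streams B'. \<exists>z\<in>streams B'. stake n z = stake n y \<and> G z \<in> streams A')"
proof -
  define g where "g = inv_into (streams A) f"
  interpret inv: sim_bij B t A r g L unfolding g_def by (rule inverse)
  have gf: "g (f x) = x" if "x \<in> streams A" for x
    using bij that by (simp add: g_def bij_betw_def inv_into_f_f)
  have fg: "f (g y) = y" if "y \<in> streams B" for y
    using bij that by (simp add: g_def bij_betw_def f_inv_into_f)
  have pos: "0 < weight r I" "0 < weight t (J I)"
    using A.weight_pos[OF I_in] B.weight_pos[OF J_in[OF I_in]] by auto
  \<comment> \<open>The bound on v makes U, defined below, lighter than I; being a prefix of a
    stream below I, it then extends I.\<close>
  obtain v where v: "v \<in> lists B'" "weight t v < weight r I / (L * weight t (J I))"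
    "\<And>w. w \<in> lists B' \<Longrightarrow> length w = n \<Longrightarrow> hit (v @ w)"
    using small_extensions_hit[OF s, of "weight r I / (L * weight t (J I))" n] pos L_ge_1 by auto
  \<comment> \<open>V is the target word and U the common prefix of its preimages. Removing both
    from the inverse of f gives G.\<close>
  define V where "V = J I @ v"
  define U where "U = inv.J V"
  have V: "V \<in> lists B" using J_in[OF I_in] B'_lists[OF v(1)] by (simp add: V_def)
  have U: "U \<in> lists A" unfolding U_def by (rule inv.J_in[OF V])
  have Upos: "0 < weight r U" and Vpos: "0 < weight t V" using A.weight_pos[OF U] B.weight_pos[OF V] .
  have UV: "weight r U \<le> L * weight t V" and VU: "weight t V \<le> L * weight r U"
    unfolding U_def using inv.J_upper[OF V] inv.J_lower[OF V] .
  define G where "G = (\<lambda>y. sdrop (length U) (g (V @- y)))"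
  have gG: "g (V @- y) = U @- G y" if "y \<in> streams B" for y
    unfolding G_def U_def by (rule stake_length_eqD[OF inv.J_prefix[OF V that]])
  have Vy: "V @- y \<in> streams B" if "y \<in> streams B" for y using V that by (simp add: shift_in_streams_iff)
  have GA: "G y \<in> streams A" if "y \<in> streams B" for y
    using inv.f_in[OF Vy[OF that]] gG[OF that] by (simp add: shift_in_streams_iff)
  have inside: "\<exists>x'\<in>streams A'. x = x' \<and> g (V @- z) = I @- x'" if "x \<in> streams A'" "F x = v @- z" for x z
    using that gf[of "I @- x"] f_eq_F[OF that(1)] I_in A'_streams[OF that(1)]
    by (auto simp: V_def shift_in_streams_iff)
  have "B' \<noteq> {}"
  proof -
    have "A' \<noteq> {}" using s(2) by auto
    then obtain a where "sconst a \<in> streams A'" using sconst_streams by (metis ex_in_conv)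
    then show ?thesis using F_in snth_in by (metis empty_iff)
  qed
  then obtain b where b: "b \<in> B'" by blast
  \<comment> \<open>One hit extension supplies an A'-stream x with image below V. Then U is a prefix
    of \<open>I @- x\<close>, and its letters after I come from x.\<close>
  have UI: "\<exists>K\<in>lists A'. U = I @ K"
  proof -
    have "replicate n b \<in> lists B'" using b by auto
    then have "hit (v @ replicate n b)" by (rule v(3)) simp
    then obtain x where x: "x \<in> streams A'" "stake (length (v @ replicate n b)) (F x) = v @ replicate n b"
      unfolding hit_def by blast
    define z where "z = sdrop (length v) (F x)"
    have "stake (length v) (F x) = v"
      using arg_cong[OF x(2), of "take (length v)"] by (simp add: take_stake)
    then have Fx: "F x = v @- z" unfolding z_def by (rule stake_length_eqD)
    have z: "z \<in> streams B" unfolding z_def by (rule sdrop_in_streams[OF B'_streams[OF F_in[OF x(1)]]])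
    have eq: "U @- G z = I @- x" using inside[OF x(1) Fx] gG[OF z] by auto
    have Ix: "I @- x \<in> streams A" using I_in A'_streams[OF x(1)] by (simp add: shift_in_streams_iff)
    have Upre: "U = stake (length U) (I @- x)" using eq by (metis stake_length_shift)
    have "weight r U \<le> L * (weight t (J I) * weight t v)" using UV by (simp add: V_def)
    also have "\<dots> < weight r I" using v(2) pos L_ge_1 by (simp add: field_simps)
    finally have less: "weight r U < weight r I" .
    have "length I \<le> length U"
    proof (rule ccontr)
      assume "\<not> length I \<le> length U"
      then have "weight r (stake (length I) (I @- x)) \<le> weight r (stake (length U) (I @- x))"
        by (intro A.weight_stake_mono[OF Ix]) simp
      then show False using less Upre by simp
    qed
    then have "U = I @ stake (length U - length I) x" using Upre by (simp add: stake_shift)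
    then show ?thesis using stake_in_lists[OF x(1)] by blast
  qed
  then obtain K where K: "K \<in> lists A'" "U = I @ K" by blast
  have scale: "weight r U * sdist r (G y) (G z) = sdist r (g (V @- y)) (g (V @- z))"
    if "y \<in> streams B" "z \<in> streams B" for y z
    using gG[OF that(1)] gG[OF that(2)] by simp
  show ?thesis
  proof (intro exI[of _ G] conjI ballI impI)
    fix y z assume yz: "y \<in> streams B" "z \<in> streams B"
    \<comment> \<open>In both bounds one factor L is the constant of f and the other compares the
      weights of U and V.\<close>
    have nn: "0 \<le> sdist t y z" "0 \<le> sdist r (G y) (G z)"
      using B.sdist_nonneg[OF yz(1)] A.sdist_nonneg[OF GA[OF yz(1)]] by auto
    have "weight t V * sdist t y z \<le> L * (weight r U * sdist r (G y) (G z))"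
      using inv.lower[OF Vy[OF yz(1)] Vy[OF yz(2)]] scale[OF yz] by simp
    also have "\<dots> \<le> L * ((L * weight t V) * sdist r (G y) (G z))"
      using UV nn L_ge_1 by (intro mult_left_mono mult_right_mono) auto
    finally have "weight t V * sdist t y z \<le> weight t V * (L * L * sdist r (G y) (G z))"
      by (simp add: mult_ac)
    then show "sdist t y z \<le> L * L * sdist r (G y) (G z)" using Vpos by simp
    have "weight r U * sdist r (G y) (G z) \<le> L * (weight t V * sdist t y z)"
      using inv.upper[OF Vy[OF yz(1)] Vy[OF yz(2)]] scale[OF yz] by simp
    also have "\<dots> \<le> L * ((L * weight r U) * sdist t y z)"
      using VU nn L_ge_1 by (intro mult_left_mono mult_right_mono) auto
    finally have "weight r U * sdist r (G y) (G z) \<le> weight r U * (L * L * sdist t y z)"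
      by (simp add: mult_ac)
    then show "sdist r (G y) (G z) \<le> L * L * sdist t y z" using Upos by simp
  next
    \<comment> \<open>By \<open>img_open\<close> for the inverse, the image of \<open>U @- x\<close>
      under f lies below V. Since \<open>K @- x\<close> is an A'-stream, the letters after V lie in
      B'.\<close>
    fix y x assume y: "y \<in> streams B'" and x: "x \<in> streams A'" and near: "L * L * sdist r (G y) x < 1"
    have yB: "y \<in> streams B" by (rule B'_streams[OF y])
    have Kx: "K @- x \<in> streams A'" using K(1) x by (simp add: shift_in_streams_iff)
    have Ux: "U @- x \<in> streams A" using U A'_streams[OF x] by (simp add: shift_in_streams_iff)
    have "L * sdist r (g (V @- y)) (U @- x) = L * (weight r U * sdist r (G y) x)"
      using gG[OF yB] by simp
    also have "\<dots> \<le> L * ((L * weight t V) * sdist r (G y) x)"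
      using UV A.sdist_nonneg[OF GA[OF yB]] L_ge_1 by (intro mult_left_mono mult_right_mono) auto
    also have "\<dots> = weight t V * (L * L * sdist r (G y) x)" by (simp add: mult_ac)
    also have "\<dots> < weight t V * 1" using near Vpos by (intro mult_strict_left_mono)
    finally have "L * sdist r (g (V @- y)) (U @- x) < weight t V" by simp
    then obtain z where z: "z \<in> streams B" "U @- x = g (V @- z)"
      using inv.img_open[OF V yB Ux] by metis
    have "V @- z = f (U @- x)" using z(2) fg[OF Vy[OF z(1)]] by simp
    also have "\<dots> = J I @- F (K @- x)" using f_eq_F[OF Kx] K(2) by simp
    finally have "v @- z = F (K @- x)" by (simp add: V_def)
    then have "v @- z \<in> streams B'" using F_in[OF Kx] by simp
    then have "z \<in> streams B'" by (simp add: shift_in_streams_iff)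
    moreover have "G z = x" using z(2) gG[OF z(1)] by simp
    ultimately show "\<exists>z\<in>streams B'. G z = x" by blast
  next
    fix y assume y: "y \<in> streams B'"
    \<comment> \<open>The A'-stream that hits this word has an image below V whose tail z agrees
      with y on n letters, and G sends z into \<open>streams A'\<close>.\<close>
    have "hit (v @ stake n y)" using v(3) stake_in_lists[OF y] by simp
    then obtain x where x: "x \<in> streams A'" "stake (length (v @ stake n y)) (F x) = v @ stake n y"
      unfolding hit_def by blast
    define z where "z = stake n y @- sdrop (length (v @ stake n y)) (F x)"
    have Fx: "F x = v @- z" using stake_length_eqD[OF x(2)] by (simp add: z_def)
    then have z: "z \<in> streams B'" using F_in[OF x(1)] by (simp add: shift_in_streams_iff)
    have "U @- G z = I @- x" using inside[OF x(1) Fx] gG[OF B'_streams[OF z]] by auto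
    then have "K @- G z = x" using K(2) by simp
    then have "G z \<in> streams A'" using x(1) by (auto simp: shift_in_streams_iff)
    moreover have "stake n z = stake n y" by (simp add: z_def stake_shift)
    ultimately show "\<exists>z\<in>streams B'. stake n z = stake n y \<and> G z \<in> streams A'" using z by blast
  qed (rule GA)
qed

end

section \<open>Limits of rescaled inverses\<close>

lemma streams_iff_stake: "x \<in> streams A \<longleftrightarrow> (\<forall>k. stake k x \<in> lists A)"
proof
  assume x: "\<forall>k. stake k x \<in> lists A"
  have "x !! k \<in> A" for k
    using x[rule_format, of "Suc k"] by (simp add: stake_Suc del: stake.simps(2))
  then show "x \<in> streams A" by (simp add: streams_iff_snth)
qed (intro allI stake_in_lists)

text \<open>Density up to n letters turns, as n grows, into a limit map with values in
  \<open>streams A'\<close>. Openness with a radius independent of n makes its image clopen, and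
  \<open>clopen_sdist_equiv\<close> replaces that image by all of \<open>streams A'\<close>.\<close>

lemma bilip_equiv_limit:
  assumes A: "alphabet A r" and B: "alphabet B t" and sub: "A' \<subseteq> A" "B' \<subseteq> B" and ne: "B' \<noteq> {}" and M: "1 \<le> M"
    and GA: "\<And>n y. y \<in> streams B \<Longrightarrow> G n y \<in> streams A"
    and G_lower: "\<And>n y z. y \<in> streams B \<Longrightarrow> z \<in> streams B \<Longrightarrow> sdist t y z \<le> M * sdist r (G n y) (G n z)"
    and G_upper: "\<And>n y z. y \<in> streams B \<Longrightarrow> z \<in> streams B \<Longrightarrow> sdist r (G n y) (G n z) \<le> M * sdist t y z"
    and G_open: "\<And>n y x. y \<in> streams B' \<Longrightarrow> x \<in> streams A' \<Longrightarrow> M * sdist r (G n y) x < 1 \<Longrightarrow> \<exists>z\<in>streams B'. G n z = x"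
    and G_dense: "\<And>n y. y \<in> streams B' \<Longrightarrow> \<exists>z\<in>streams B'. stake n z = stake n y \<and> G n z \<in> streams A'"
  shows "bilip_equiv (streams B') (sdist t) (streams A') (sdist r)"
proof -
  interpret A: alphabet A r by fact
  interpret B: alphabet B t by fact
  interpret A': alphabet A' r
    using A.finite_alphabet sub(1) A.ratio_pos A.ratio_less_1 by unfold_locales (auto intro: finite_subset)
  have B'B: "y \<in> streams B" if "y \<in> streams B'" for y using that sub(2) by (rule streams_mono)
  have A'A: "x \<in> streams A" if "x \<in> streams A'" for x using that sub(1) by (rule streams_mono)
  have "\<exists>m. M * B.rmax ^ m < A.rmin ^ k" for k
    using B.rmax_pow_small[of "A.rmin ^ k / M"] A.rmin_pos M by (auto simp: field_simps)
  then obtain \<mu> where \<mu>: "\<And>k. M * B.rmax ^ \<mu> k < A.rmin ^ k" by metis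
  have modulus: "stake k x = stake k x'"
    if "y \<in> streams B" "stake (\<mu> k) y = stake (\<mu> k) z" "x \<in> streams A" "sdist r x x' \<le> M * sdist t y z" for k x x' y z
  proof (rule ccontr)
    assume "stake k x \<noteq> stake k x'"
    then have "A.rmin ^ k \<le> sdist r x x'" by (rule A.sdist_ge_pow[OF that(3)])
    also have "\<dots> \<le> M * B.rmax ^ \<mu> k"
      using order_trans[OF that(4) mult_left_mono[OF B.sdist_le_pow[OF that(1,2)]]] M by simp
    finally show False using \<mu>[of k] by simp
  qed
  have G_modulus: "stake k (G n y) = stake k (G n z)"
    if "y \<in> streams B" "z \<in> streams B" "stake (\<mu> k) y = stake (\<mu> k) z" for k n y z
    using modulus[OF that(1,3) GA[OF that(1)] G_upper[OF that(1,2)]] .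
  obtain g where gA: "\<And>y. y \<in> streams B' \<Longrightarrow> g y \<in> streams A"
    and g: "\<And>k N. \<exists>n\<ge>N. \<forall>y\<in>streams B'. stake k (g y) = stake k (G n y)"
  proof (rule equicontinuous_limit[OF A.finite_alphabet B.finite_alphabet, of "streams B'" G])
    show "\<exists>m. \<forall>n. \<forall>x\<in>streams B'. \<forall>y\<in>streams B'. stake m x = stake m y \<longrightarrow> stake k (G n x) = stake k (G n y)" for k
      by (intro exI[of _ "\<mu> k"]) (use G_modulus B'B in blast)
  qed (use B'B GA in auto)
  have gA': "g y \<in> streams A'" if y: "y \<in> streams B'" for y
    unfolding streams_iff_stake
  proof
    fix k
    obtain n where n: "n \<ge> \<mu> k" "stake k (g y) = stake k (G n y)" using g[of "\<mu> k" k] y by blast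
    obtain z where z: "z \<in> streams B'" "stake n z = stake n y" "G n z \<in> streams A'" using G_dense[OF y] by blast
    have "stake k (G n y) = stake k (G n z)"
      using G_modulus[OF B'B[OF y] B'B[OF z(1)]] stake_eq_mono[OF z(2) n(1)] by simp
    then show "stake k (g y) \<in> lists A'" using n(2) stake_in_lists[OF z(3)] by simp
  qed
  have g_bilip: "sdist t y z \<le> M * sdist r (g y) (g z) \<and> sdist r (g y) (g z) \<le> M * sdist t y z"
    if y: "y \<in> streams B'" and z: "z \<in> streams B'" for y z
  proof (cases "y = z")
    case False
    then have "0 < sdist t y z" using B.sdist_pos B'B[OF y] by blast
    \<comment> \<open>By the lower bound, k letters separate the images of y and z under every
      \<open>G n\<close>; where g and \<open>G n\<close> agree on k letters, their distances
      coincide by \<open>sdist_cong\<close>.\<close>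
    then obtain k where k: "A.rmax ^ k < sdist t y z / M" using A.rmax_pow_small[of "sdist t y z / M"] M by auto
    obtain n where n: "\<forall>y\<in>streams B'. stake k (g y) = stake k (G n y)" using g by blast
    have "stake k (G n y) \<noteq> stake k (G n z)"
    proof
      assume "stake k (G n y) = stake k (G n z)"
      then have "sdist r (G n y) (G n z) \<le> A.rmax ^ k" by (rule A.sdist_le_pow[OF GA[OF B'B[OF y]]])
      then have "M * sdist r (G n y) (G n z) < sdist t y z" using k M by (simp add: pos_less_divide_eq mult.commute[of _ M] le_less_trans[OF mult_left_mono])
      then show False using G_lower[OF B'B[OF y] B'B[OF z], of n] by simp
    qed
    then have "sdist r (g y) (g z) = sdist r (G n y) (G n z)"
      using n y z by (intro sdist_cong[of k]) auto
    then show ?thesis using G_lower[OF B'B[OF y] B'B[OF z], of n] G_upper[OF B'B[OF y] B'B[OF z], of n] by simp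
  qed simp
  \<comment> \<open>The radius of openness in letters, the same for every n.\<close>
  obtain \<eta> where \<eta>: "A.rmax ^ \<eta> < 1 / M" using A.rmax_pow_small[of "1 / M"] M by auto
  have g_open: "x \<in> g ` streams B'" if y: "y \<in> streams B'" and x: "x \<in> streams A'" and near: "stake \<eta> (g y) = stake \<eta> x" for x y
  proof -
    have "\<exists>z. z \<in> streams B' \<and> stake k (g z) = stake k x" for k
    proof -
      obtain n where n: "\<forall>y\<in>streams B'. stake (max k \<eta>) (g y) = stake (max k \<eta>) (G n y)" using g by blast
      have "stake \<eta> (G n y) = stake \<eta> x"
        using stake_eq_mono[OF n[rule_format, OF y], of \<eta>] near by simp
      then have "sdist r (G n y) x \<le> A.rmax ^ \<eta>" by (rule A.sdist_le_pow[OF GA[OF B'B[OF y]]])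
      then have "M * sdist r (G n y) x \<le> M * A.rmax ^ \<eta>" using M by (intro mult_left_mono) auto
      also have "\<dots> < 1" using \<eta> M by (simp add: field_simps)
      finally obtain z where z: "z \<in> streams B'" "G n z = x" using G_open[OF y x] by blast
      then have "stake k (g z) = stake k x"
        using stake_eq_mono[OF n[rule_format, OF z(1)], of k] by simp
      then show ?thesis using z(1) by blast
    qed
    \<comment> \<open>Each \<open>\<zeta> k\<close> is a preimage of x up to k letters; by
      continuity of g a cluster point of them is an exact preimage.\<close>
    then obtain \<zeta> where \<zeta>: "\<And>k. \<zeta> k \<in> streams B'" "\<And>k. stake k (g (\<zeta> k)) = stake k x" by metis
    have "finite B'" using sub(2) B.finite_alphabet finite_subset by blast
    then obtain z where z: "z \<in> streams B'" "\<And>k N. \<exists>n\<ge>N. stake k z = stake k (\<zeta> n)"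
      using streams_cluster_point[of B' \<zeta>] \<zeta>(1) by blast
    have "stake k (g z) = stake k x" for k
    proof -
      obtain n where n: "n \<ge> k" "stake (\<mu> k) z = stake (\<mu> k) (\<zeta> n)" using z(2) by blast
      have "stake k (g z) = stake k (g (\<zeta> n))"
        using modulus[OF B'B[OF z(1)] n(2) gA[OF z(1)]] g_bilip[OF z(1) \<zeta>(1)] by blast
      also have "\<dots> = stake k x" by (rule stake_eq_mono[OF \<zeta>(2) n(1)])
      finally show ?thesis .
    qed
    then have "g z = x" by (simp add: stream_eq_iff[of "g z" x])
    then show ?thesis using z(1) by blast
  qed
  have "inj_on g (streams B')"
  proof (rule inj_onI, rule ccontr)
    fix y z assume yz: "y \<in> streams B'" "z \<in> streams B'" "g y = g z" "y \<noteq> z"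
    then have "sdist t y z \<le> 0" using g_bilip[OF yz(1,2)] by simp
    then show False using B.sdist_pos[OF B'B[OF yz(1)] yz(4)] by simp
  qed
  then have 1: "bilip_equiv (streams B') (sdist t) (g ` streams B') (sdist r)"
    by (intro bilip_equivI[of g, OF _ M]) (auto simp: bij_betw_def g_bilip)
  have 2: "bilip_equiv (streams A') (sdist r) (g ` streams B') (sdist r)"
  proof (rule A'.clopen_sdist_equiv)
    show "g ` streams B' \<subseteq> streams A'" using gA' by blast
    show "g ` streams B' \<noteq> {}" using ne by (simp add: streams_empty_iff)
    show "x \<in> g ` streams B'" if "u \<in> g ` streams B'" "x \<in> streams A'" "stake \<eta> u = stake \<eta> x" for u x
      using that g_open by blast
  qed
  show ?thesis by (rule bilip_equiv_trans[OF 1 bilip_equiv_sym[OF 2]])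
qed

section \<open>Coding of attractors\<close>

lemma ratio_eqI:
  fixes f :: "'a::euclidean_space \<Rightarrow> 'a"
  assumes "similarity_with_ratio c f"
  shows "ratio f = c"
  unfolding ratio_def
proof (rule the_equality)
  fix d assume d: "similarity_with_ratio d f"
  obtain b :: 'a where "b \<in> Basis" using nonempty_Basis by blast
  then have "dist b 0 \<noteq> 0" by auto
  then show "d = c" using assms d unfolding similarity_with_ratio_def by (metis mult_right_cancel)
qed fact

lemma contracting_ratio:
  fixes f :: "'a::euclidean_space \<Rightarrow> 'a"
  assumes "contracting_similarity f"
  shows "0 < ratio f" "ratio f < 1" "dist (f x) (f y) = ratio f * dist x y"
proof -
  obtain c where c: "0 < c" "c < 1" "similarity_with_ratio c f"
    using assms unfolding contracting_similarity_def by blast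
  with ratio_eqI[OF c(3)] show "0 < ratio f" "ratio f < 1" "dist (f x) (f y) = ratio f * dist x y"
    by (simp_all add: similarity_with_ratio_def)
qed

primrec compose_word :: "('a \<Rightarrow> 'a) list \<Rightarrow> 'a \<Rightarrow> 'a" where
  "compose_word [] x = x"
| "compose_word (f # w) x = f (compose_word w x)"

lemma compose_word_append: "compose_word (v @ w) x = compose_word v (compose_word w x)"
  by (induct v) simp_all

text \<open>By \<open>coding_limit\<close> the base point 0 is immaterial. The family does not occur
  in the definition, so an address over a subfamily denotes the same point for both
  families.\<close>

definition coding :: "('a::euclidean_space \<Rightarrow> 'a) stream \<Rightarrow> 'a" where
  "coding s = lim (\<lambda>n. compose_word (stake n s) 0)"

locale ifs =
  fixes S :: "('a::euclidean_space \<Rightarrow> 'a) set"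
  assumes IFS: "IFS S"

sublocale ifs \<subseteq> alphabet S ratio
  using IFS by unfold_locales (auto simp: IFS_def contracting_ratio)

context ifs
begin

lemma dist_map: "f \<in> S \<Longrightarrow> dist (f x) (f y) = ratio f * dist x y"
  using IFS contracting_ratio(3) by (auto simp: IFS_def)

lemma isCont_map: "f \<in> S \<Longrightarrow> isCont f x"
proof -
  assume f: "f \<in> S"
  then have "(ratio f)-lipschitz_on UNIV f"
    using dist_map ratio_pos by (auto simp: lipschitz_on_def less_imp_le)
  then have "continuous_on UNIV f" by (rule lipschitz_on_continuous_on)
  then show "isCont f x" by (simp add: continuous_on_eq_continuous_at)
qed

lemma dist_compose_word: "w \<in> lists S \<Longrightarrow> dist (compose_word w x) (compose_word w y) = weight ratio w * dist x y"
  by (induct w) (simp_all add: dist_map)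

lemma invariant_ball: "\<exists>R\<ge>0. \<forall>f\<in>S. \<forall>x. norm x \<le> R \<longrightarrow> norm (f x) \<le> R"
proof -
  define M where "M = Max (insert 0 ((\<lambda>f. norm (f 0)) ` S))"
  have M: "0 \<le> M" "\<And>f. f \<in> S \<Longrightarrow> norm (f 0) \<le> M"
    using finite_alphabet by (auto simp: M_def)
  \<comment> \<open>The solution of \<open>M + rmax * R = R\<close>.\<close>
  define R where "R = M / (1 - rmax)"
  have R: "0 \<le> R" "M + rmax * R = R"
    using M rmax_less_1 by (auto simp: R_def field_simps)
  have "norm (f x) \<le> R" if "f \<in> S" "norm x \<le> R" for f x
  proof -
    have "norm (f x) \<le> norm (f 0) + dist (f x) (f 0)"
      by (metis add.commute dist_norm norm_triangle_sub)
    also have "\<dots> \<le> M + rmax * R"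
      using M(2)[OF that(1)] dist_map[OF that(1), of x 0] le_rmax[OF that(1)] that rmax_pos
      by (auto intro!: add_mono mult_mono)
    finally show ?thesis using R by simp
  qed
  then show ?thesis using R by blast
qed

lemma compose_word_bound:
  assumes "\<forall>f\<in>S. \<forall>x. norm x \<le> R \<longrightarrow> norm (f x) \<le> R" "w \<in> lists S" "norm x \<le> R"
  shows "norm (compose_word w x) \<le> R"
  using assms(2)
proof (induct w)
  case (Cons f w)
  then have "norm (f (compose_word w x)) \<le> R" using assms(1) by simp
  then show ?case by simp
qed (use assms(3) in simp)

text \<open>From stage n on, the compositions stay in the image of an invariant ball under the first
  n maps, hence form a Cauchy sequence; the starting point is forgotten at the rate
  \<open>rmax ^ n\<close>.\<close>

lemma coding_limit:
  assumes s: "s \<in> streams S"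
  shows "(\<lambda>n. compose_word (stake n s) x) \<longlonglongrightarrow> coding s"
proof -
  obtain R where R: "R \<ge> 0" "\<forall>f\<in>S. \<forall>x. norm x \<le> R \<longrightarrow> norm (f x) \<le> R"
    using invariant_ball by blast
  have tail: "dist (compose_word (stake n s) 0) (compose_word (stake m s) 0) \<le> rmax ^ n * R" if "n \<le> m" for n m
  proof -
    let ?v = "stake (m - n) (sdrop n s)"
    have v: "?v \<in> lists S" using s by (intro stake_in_lists sdrop_in_streams)
    have "dist (compose_word (stake n s) 0) (compose_word (stake m s) 0)
        = weight ratio (stake n s) * norm (compose_word ?v 0)"
      using dist_compose_word[OF stake_in_lists[OF s], of n 0 "compose_word ?v 0"] arg_cong[OF stake_le_append[OF that, of s], of "\<lambda>w. compose_word w 0"]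
      by (simp add: compose_word_append del: stake_add)
    also have "\<dots> \<le> rmax ^ n * R"
      using weight_le_pow[OF stake_in_lists[OF s], of n] compose_word_bound[OF R(2) v, of 0] R(1) rmax_pos
      by (intro mult_mono) auto
    finally show ?thesis .
  qed
  have "Cauchy (\<lambda>n. compose_word (stake n s) 0)"
    unfolding Cauchy_altdef
  proof (intro allI impI)
    fix e :: real assume "0 < e"
    then obtain M where "rmax ^ M < e / (R + 1)" using rmax_pow_small[of "e / (R + 1)"] R by auto
    then have "rmax ^ M * (R + 1) < e" using R by (simp add: field_simps)
    then have "rmax ^ m * R < e" if "m \<ge> M" for m
      using rmax_pow_mono[OF that] R rmax_pos mult_mono[of "rmax ^ m" "rmax ^ M" R "R + 1"]
      by (auto intro: le_less_trans)
    then show "\<exists>M. \<forall>m\<ge>M. \<forall>n>m. dist (compose_word (stake m s) 0) (compose_word (stake n s) 0) < e"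
      using tail by (meson le_less_trans less_imp_le)
  qed
  then have lim0: "(\<lambda>n. compose_word (stake n s) 0) \<longlonglongrightarrow> coding s"
    unfolding coding_def by (simp add: Cauchy_convergent_iff convergent_LIMSEQ_iff)
  have "(\<lambda>n. rmax ^ n * norm x) \<longlonglongrightarrow> 0"
    using rmax_less_1 rmax_pos by (intro tendsto_mult_left_zero LIMSEQ_power_zero) auto
  then have "(\<lambda>n. dist (compose_word (stake n s) x) (compose_word (stake n s) 0)) \<longlonglongrightarrow> 0"
  proof (rule Lim_null_comparison[rotated], intro always_eventually allI)
    fix n show "norm (dist (compose_word (stake n s) x) (compose_word (stake n s) 0)) \<le> rmax ^ n * norm x"
      using weight_le_pow[OF stake_in_lists[OF s], of n] weight_stake_pos[OF s, of n]
        dist_compose_word[OF stake_in_lists[OF s], of n x 0] by (auto simp: mult_right_mono)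
  qed
  then have "(\<lambda>n. compose_word (stake n s) x - compose_word (stake n s) 0) \<longlonglongrightarrow> 0"
    unfolding dist_norm by (rule tendsto_norm_zero_cancel)
  with lim0 show ?thesis by (rule Lim_transform)
qed

lemma coding_Stream: "f \<in> S \<Longrightarrow> s \<in> streams S \<Longrightarrow> coding (f ## s) = f (coding s)"
proof -
  assume f: "f \<in> S" and s: "s \<in> streams S"
  have "(\<lambda>n. compose_word (stake (Suc n) (f ## s)) 0) \<longlonglongrightarrow> coding (f ## s)"
    using f s by (intro LIMSEQ_Suc coding_limit) auto
  moreover have "(\<lambda>n. compose_word (stake (Suc n) (f ## s)) 0) \<longlonglongrightarrow> f (coding s)"
    using isCont_tendsto_compose[OF isCont_map[OF f] coding_limit[OF s, of 0]] by simp
  ultimately show ?thesis by (rule LIMSEQ_unique)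
qed

lemma coding_shift: "w \<in> lists S \<Longrightarrow> s \<in> streams S \<Longrightarrow> coding (w @- s) = compose_word w (coding s)"
  by (induct w) (auto simp: coding_Stream shift_in_streams_iff)

lemma coding_bounded: "\<exists>R\<ge>0. \<forall>s\<in>streams S. norm (coding s) \<le> R"
proof -
  obtain R where R: "R \<ge> 0" "\<forall>f\<in>S. \<forall>x. norm x \<le> R \<longrightarrow> norm (f x) \<le> R"
    using invariant_ball by blast
  have "norm (coding s) \<le> R" if "s \<in> streams S" for s
    using LIMSEQ_le_const2[OF tendsto_norm[OF coding_limit[OF that, of 0]]]
      compose_word_bound[OF R(2) stake_in_lists[OF that], of 0] R by auto
  then show ?thesis using R by blast
qed

lemma coding_Lipschitz:
  "\<exists>C\<ge>0. \<forall>x\<in>streams S. \<forall>y\<in>streams S. dist (coding x) (coding y) \<le> C * sdist ratio x y"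
proof -
  obtain R where R: "R \<ge> 0" "\<forall>s\<in>streams S. norm (coding s) \<le> R" using coding_bounded by blast
  have "dist (coding x) (coding y) \<le> (2 * R) * sdist ratio x y" if xy: "x \<in> streams S" "y \<in> streams S" for x y
  proof (cases "x = y")
    case False
    then obtain n where n: "stake n x = stake n y" "x !! n \<noteq> y !! n" by (rule stream_split)
    have "dist (coding x) (coding y) = weight ratio (stake n x) * dist (coding (sdrop n x)) (coding (sdrop n y))"
      using dist_compose_word coding_shift stake_in_lists[OF xy(1)] stake_in_lists[OF xy(2)] sdrop_in_streams xy n
      by (metis stake_sdrop)
    moreover have "dist (coding (sdrop n x)) (coding (sdrop n y)) \<le> 2 * R"
      using R(2) sdrop_in_streams[OF xy(1), of n] sdrop_in_streams[OF xy(2), of n]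
      by (smt (verit, best) dist_norm norm_triangle_ineq4)
    ultimately show ?thesis using sdist_eqI[OF n, of ratio] weight_stake_pos[OF xy(1), of n]
      by (simp add: mult.commute)
  qed simp
  then show ?thesis using R by (intro exI[of _ "2 * R"]) auto
qed

lemma coding_invariant: "coding ` streams S = (\<Union>f\<in>S. f ` coding ` streams S)"
proof
  show "coding ` streams S \<subseteq> (\<Union>f\<in>S. f ` coding ` streams S)"
  proof
    fix x assume "x \<in> coding ` streams S"
    then obtain f s where "f ## s \<in> streams S" "x = coding (f ## s)"
      by (metis imageE stream.collapse)
    then have "f \<in> S" "s \<in> streams S" "x = f (coding s)"
      by (auto simp: streams_Stream coding_Stream)
    then show "x \<in> (\<Union>f\<in>S. f ` coding ` streams S)" by blast
  qed
  show "(\<Union>f\<in>S. f ` coding ` streams S) \<subseteq> coding ` streams S"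
  proof clarify
    fix f s assume fs: "f \<in> S" "s \<in> streams S"
    then have "f (coding s) = coding (f ## s)" by (simp add: coding_Stream)
    then show "f (coding s) \<in> coding ` streams S" using fs by simp
  qed
qed

lemma compact_coding: "compact (coding ` streams S)"
proof -
  obtain C where C: "C \<ge> 0" "\<And>x y. x \<in> streams S \<Longrightarrow> y \<in> streams S \<Longrightarrow> dist (coding x) (coding y) \<le> C * sdist ratio x y"
    using coding_Lipschitz by blast
  have "closed (coding ` streams S)"
    unfolding closed_sequential_limits
  proof (intro allI impI, elim conjE)
    fix e l assume e: "\<forall>n. e n \<in> coding ` streams S" and l: "e \<longlonglongrightarrow> l"
    from e have "\<forall>n. \<exists>s. s \<in> streams S \<and> e n = coding s" by auto
    then obtain x where x: "\<And>n. x n \<in> streams S" "\<And>n. e n = coding (x n)" by metis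
    \<comment> \<open>The addresses of the points \<open>e n\<close> cluster at some y; as
      \<open>coding\<close> is Lipschitz, y is an address of the limit.\<close>
    obtain y where y: "y \<in> streams S" "\<And>k N. \<exists>n\<ge>N. stake k y = stake k (x n)"
      using streams_cluster_point[of S x] finite_alphabet x(1) by blast
    have "dist l (coding y) \<le> d" if "0 < d" for d
    proof -
      obtain N where N: "\<And>n. n \<ge> N \<Longrightarrow> dist (e n) l < d / 2"
        using l \<open>0 < d\<close> unfolding LIMSEQ_def by (meson half_gt_zero)
      obtain k where k: "rmax ^ k < d / 2 / (C + 1)" using rmax_pow_small[of "d / 2 / (C + 1)"] C \<open>0 < d\<close> by auto
      obtain n where n: "n \<ge> N" "stake k y = stake k (x n)" using y by blast
      have "dist (coding y) (coding (x n)) \<le> C * rmax ^ k"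
        using C(2)[OF y(1) x(1)] mult_left_mono[OF sdist_le_pow[OF y(1) n(2)] C(1)] by (rule order_trans)
      also have "\<dots> \<le> (C + 1) * rmax ^ k" using rmax_pos by simp
      also have "\<dots> < d / 2" using k C(1) by (simp add: field_simps)
      finally show ?thesis using N[OF n(1)] x(2)[of n] dist_triangle3[of l "coding y" "e n"]
        by (simp add: dist_commute)
    qed
    then have "dist l (coding y) \<le> 0" by (metis field_le_epsilon add_0)
    then show "l \<in> coding ` streams S" using y by simp
  qed
  moreover have "bounded (coding ` streams S)"
    using coding_bounded by (auto simp: bounded_iff)
  ultimately show ?thesis by (simp add: compact_eq_bounded_closed)
qed

lemma attractor_unique:
  assumes K: "K \<noteq> {}" "compact K" "K = (\<Union>f\<in>S. f ` K)"
  shows "K = coding ` streams S"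
proof
  have KS: "f z \<in> K" if "f \<in> S" "z \<in> K" for f z
    by (rule subsetD[OF equalityD2[OF K(3)] UN_I[OF that(1) imageI[OF that(2)]]])
  show "coding ` streams S \<subseteq> K"
  proof
    fix x assume "x \<in> coding ` streams S"
    then obtain s where s: "s \<in> streams S" "x = coding s" by blast
    obtain z where "z \<in> K" using K(1) by auto
    then have "compose_word w z \<in> K" if "w \<in> lists S" for w
      using that by (induct w) (auto intro: KS)
    then have "\<forall>n. compose_word (stake n s) z \<in> K" using stake_in_lists[OF s(1)] by blast
    then show "x \<in> K"
      using coding_limit[OF s(1), of z] closed_sequentially[OF compact_imp_closed[OF K(2)], of "\<lambda>n. compose_word (stake n s) z"] s(2) by simp
  qed
  show "K \<subseteq> coding ` streams S"
  proof
    fix x assume x: "x \<in> K"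
    \<comment> \<open>An address of x is built by pulling x back inside K. Each \<open>p n\<close>
      pairs a map with a point, the point being the image of the next point under the next map; the
      map in \<open>p 0\<close> is a dummy, whence \<open>p (Suc n)\<close> in the address.\<close>
    define Q where "Q = (\<lambda>(n::nat) (p::('a \<Rightarrow> 'a) \<times> 'a). snd p \<in> K \<and> (n = 0 \<longrightarrow> snd p = x))"
    define R where "R = (\<lambda>(n::nat) (p::('a \<Rightarrow> 'a) \<times> 'a) (q::('a \<Rightarrow> 'a) \<times> 'a). fst q \<in> S \<and> snd p = fst q (snd q))"
    have "\<exists>p. \<forall>n. Q n (p n) \<and> R n (p n) (p (Suc n))"
    proof (rule dependent_nat_choice)
      show "\<exists>p. Q 0 p" using x by (simp add: Q_def)
      fix p :: "('a \<Rightarrow> 'a) \<times> 'a" and n :: nat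
      assume "Q n p"
      then have "snd p \<in> (\<Union>f\<in>S. f ` K)" using subsetD[OF equalityD1[OF K(3)]] by (simp add: Q_def)
      then obtain f z where "f \<in> S" "z \<in> K" "snd p = f z" by auto
      then show "\<exists>q. Q (Suc n) q \<and> R n p q"
        by (intro exI[of _ "(f, z)"]) (simp add: Q_def R_def)
    qed
    then obtain p where pQR: "\<forall>n. Q n (p n) \<and> R n (p n) (p (Suc n))" ..
    have QR: "Q n (p n)" "R n (p n) (p (Suc n))" for n using pQR by simp_all
    have p: "snd (p n) \<in> K" "snd (p 0) = x" "fst (p (Suc n)) \<in> S"
      "snd (p n) = fst (p (Suc n)) (snd (p (Suc n)))" for n
      using QR(1)[of n] QR(1)[of 0] QR(2)[of n] unfolding Q_def R_def by (elim conjE, simp only: simp_thms)+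
    define s where "s = smap (\<lambda>n. fst (p (Suc n))) nats"
    have s: "s \<in> streams S" using p(3) by (auto simp: s_def streams_iff_snth)
    have eq: "x = compose_word (stake n s) (snd (p n))" for n
    proof (induct n)
      case (Suc n)
      have "compose_word (stake (Suc n) s) (snd (p (Suc n))) = compose_word (stake n s) (fst (p (Suc n)) (snd (p (Suc n))))"
        by (simp add: stake_Suc s_def compose_word_append del: stake.simps(2))
      moreover from Suc have "x = compose_word (stake n s) (fst (p (Suc n)) (snd (p (Suc n))))"
        by (simp only: p(4)[of n])
      ultimately show ?case by (rule trans[OF _ sym, rotated])
    qed (simp add: p(2))
    define M where "M = diameter K"
    have M: "z \<in> K \<Longrightarrow> z' \<in> K \<Longrightarrow> dist z z' \<le> M" for z z'
      unfolding M_def by (rule diameter_bounded_bound[OF compact_imp_bounded[OF K(2)]])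
    have "(\<lambda>n. dist (compose_word (stake n s) x) x) \<longlonglongrightarrow> 0"
    proof (rule Lim_null_comparison[where g = "\<lambda>n. rmax ^ n * M"], intro always_eventually allI)
      fix n
      have "dist (compose_word (stake n s) x) x = weight ratio (stake n s) * dist x (snd (p n))"
        using dist_compose_word[OF stake_in_lists[OF s]] eq[of n] by metis
      also have "\<dots> \<le> rmax ^ n * M"
        using weight_le_pow[OF stake_in_lists[OF s], of n] M[OF x p(1)] weight_stake_pos[OF s, of n] rmax_pos
        by (intro mult_mono) auto
      finally show "norm (dist (compose_word (stake n s) x) x) \<le> rmax ^ n * M" by simp
    next
      show "(\<lambda>n. rmax ^ n * M) \<longlonglongrightarrow> 0"
        using rmax_less_1 rmax_pos by (intro tendsto_mult_left_zero LIMSEQ_power_zero) auto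
    qed
    then have "(\<lambda>n. compose_word (stake n s) x) \<longlonglongrightarrow> x" by (subst tendsto_dist_iff)
    with coding_limit[OF s, of x] have "x = coding s" by (rule LIMSEQ_unique[rotated])
    then show "x \<in> coding ` streams S" using s by blast
  qed
qed

lemma attractor_eq: "S \<noteq> {} \<Longrightarrow> attractor S = coding ` streams S"
  unfolding attractor_def
proof (rule the_equality)
  assume "S \<noteq> {}"
  then show "coding ` streams S \<noteq> {} \<and> compact (coding ` streams S) \<and> coding ` streams S = (\<Union>f\<in>S. f ` coding ` streams S)"
    by (intro conjI compact_coding coding_invariant) (simp add: streams_empty_iff)
qed (elim conjE, rule attractor_unique)

text \<open>Different first letters put points into disjoint compact pieces; being finitely many,
  these have a common gap c, which a common prefix scales by its weight.\<close>

lemma coding_expanding: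
  assumes "strong_separation S" "S \<noteq> {}"
  shows "\<exists>c>0. \<forall>x\<in>streams S. \<forall>y\<in>streams S. c * sdist ratio x y \<le> dist (coding x) (coding y)"
proof -
  let ?E = "coding ` streams S"
  have sep: "\<exists>d>0. \<forall>x\<in>f ` ?E. \<forall>y\<in>g ` ?E. d \<le> dist x y" if "f \<in> S" "g \<in> S" "f \<noteq> g" for f g
  proof (rule separate_compact_closed)
    have "compact (h ` ?E)" if "h \<in> S" for h
      by (intro compact_continuous_image compact_coding continuous_at_imp_continuous_on ballI isCont_map that)
    then show "compact (f ` ?E)" "closed (g ` ?E)" using that(1,2) by (auto intro: compact_imp_closed)
    show "f ` ?E \<inter> g ` ?E = {}"
      using assms(1) that unfolding strong_separation_def attractor_eq[OF assms(2)] disjoint_family_on_def by simp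
  qed
  define P where "P = {p \<in> S \<times> S. fst p \<noteq> snd p}"
  have "\<exists>d. \<forall>p\<in>P. 0 < d p \<and> (\<forall>x\<in>fst p ` ?E. \<forall>y\<in>snd p ` ?E. d p \<le> dist x y)"
  proof (rule bchoice, rule ballI)
    fix p assume "p \<in> P"
    then show "\<exists>d>0. \<forall>x\<in>fst p ` ?E. \<forall>y\<in>snd p ` ?E. d \<le> dist x y"
      using sep[of "fst p" "snd p"] by (auto simp: P_def)
  qed
  then obtain d where d: "\<forall>p\<in>P. 0 < d p \<and> (\<forall>x\<in>fst p ` ?E. \<forall>y\<in>snd p ` ?E. d p \<le> dist x y)" ..
  \<comment> \<open>The 1 covers a family with a single map, for which P is empty.\<close>
  define c where "c = Min (insert 1 (d ` P))"
  have fin: "finite P" using finite_alphabet by (simp add: P_def)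
  have "0 < c" using fin d by (auto simp: c_def)
  have c: "c \<le> dist a b" if "a \<in> f ` ?E" "b \<in> g ` ?E" "f \<in> S" "g \<in> S" "f \<noteq> g" for a b f g
  proof -
    have "(f, g) \<in> P" using that by (simp add: P_def)
    then have "c \<le> d (f, g)" unfolding c_def using fin by (intro Min_le) auto
    also have "d (f, g) \<le> dist a b" using d \<open>(f, g) \<in> P\<close> that(1,2) by fastforce
    finally show ?thesis .
  qed
  have "c * sdist ratio x y \<le> dist (coding x) (coding y)" if xy: "x \<in> streams S" "y \<in> streams S" for x y
  proof (cases "x = y")
    case False
    then obtain n where n: "stake n x = stake n y" "x !! n \<noteq> y !! n" by (rule stream_split)
    let ?x = "sdrop n x" and ?y = "sdrop n y"
    have in_image: "coding (sdrop n z) \<in> (z !! n) ` ?E \<and> z !! n \<in> S" if "z \<in> streams S" for z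
    proof -
      have "sdrop n z = (z !! n) ## sdrop (Suc n) z" by (metis sdrop_simps stream.collapse)
      then show ?thesis using coding_Stream[of "z !! n" "sdrop (Suc n) z"] that sdrop_in_streams[OF that, of "Suc n"] snth_in[OF that]
        by (auto simp del: sdrop.simps)
    qed
    have "c \<le> dist (coding ?x) (coding ?y)"
      using c n in_image[OF xy(1)] in_image[OF xy(2)] by blast
    moreover have "dist (coding x) (coding y) = weight ratio (stake n x) * dist (coding ?x) (coding ?y)"
      using dist_compose_word coding_shift stake_in_lists[OF xy(1)] stake_in_lists[OF xy(2)] sdrop_in_streams xy n
      by (metis stake_sdrop)
    ultimately show ?thesis using sdist_eqI[OF n, of ratio] weight_stake_pos[OF xy(1), of n]
      by (simp add: mult.commute)
  qed simp
  with \<open>0 < c\<close> show ?thesis by blast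
qed

text \<open>The separation constant of the whole family is inherited by addresses over S', so no
  separation has to be proved for the attractor of S'.\<close>

lemma bilip_equiv_attractor:
  assumes "strong_separation S" "S' \<subseteq> S" "S' \<noteq> {}"
  shows "bilip_equiv (streams S') (sdist ratio) (attractor S') dist"
proof -
  interpret S': ifs S'
    using IFS assms(2) by unfold_locales (auto simp: IFS_def intro: finite_subset)
  obtain c where c: "c > 0" "\<forall>x\<in>streams S. \<forall>y\<in>streams S. c * sdist ratio x y \<le> dist (coding x) (coding y)"
    using coding_expanding assms by auto
  obtain C where C: "C \<ge> 0" "\<forall>x\<in>streams S. \<forall>y\<in>streams S. dist (coding x) (coding y) \<le> C * sdist ratio x y"
    using coding_Lipschitz by auto
  have sub: "x \<in> streams S" if "x \<in> streams S'" for x using that assms(2) by (rule streams_mono)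
  have "x = y" if "x \<in> streams S" "y \<in> streams S" "coding x = coding y" for x y
    using c(2)[rule_format, OF that(1,2)] that c(1) sdist_pos[of x y] by (auto simp: mult_le_0_iff)
  then have "inj_on coding (streams S')" using sub by (auto intro!: inj_onI)
  then have bij: "bij_betw coding (streams S') (attractor S')"
    unfolding bij_betw_def S'.attractor_eq[OF assms(3)] by simp
  define L where "L = max 1 (max C (1 / c))"
  then have L: "1 \<le> L" "C \<le> L" "1 / c \<le> L" by simp_all
  then have Lc: "1 \<le> L * c" using c(1) by (simp add: pos_divide_le_eq)
  show ?thesis
  proof (rule bilip_equivI[OF bij L(1)])
    fix x y assume "x \<in> streams S'" "y \<in> streams S'"
    then have xy: "x \<in> streams S" "y \<in> streams S" using sub by auto
    note nn = sdist_nonneg[OF xy(1), of y]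
    have "sdist ratio x y \<le> (L * c) * sdist ratio x y" using mult_right_mono[OF Lc nn] by simp
    also have "\<dots> \<le> L * dist (coding x) (coding y)"
      using mult_left_mono[of "c * sdist ratio x y" "dist (coding x) (coding y)" L] c(2) xy L(1) by (simp add: mult.assoc)
    finally show "sdist ratio x y \<le> L * dist (coding x) (coding y)" .
    have "dist (coding x) (coding y) \<le> C * sdist ratio x y" using C(2) xy by blast
    also have "\<dots> \<le> L * sdist ratio x y" using L(2) nn by (rule mult_right_mono)
    finally show "dist (coding x) (coding y) \<le> L * sdist ratio x y" .
  qed
qed

end

lemma Lipschitz_equivalent_attractors:
  fixes S :: "('a::euclidean_space \<Rightarrow> 'a) set" and T :: "('b::euclidean_space \<Rightarrow> 'b) set"
  assumes "IFS S" "strong_separation S" "S' \<subseteq> S" "S' \<noteq> {}"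
    and "IFS T" "strong_separation T" "T' \<subseteq> T" "T' \<noteq> {}"
  shows "Lipschitz_equivalent (attractor S') (attractor T') \<longleftrightarrow>
    bilip_equiv (streams S') (sdist ratio) (streams T') (sdist ratio)"
proof -
  interpret S: ifs S by unfold_locales fact
  interpret T: ifs T by unfold_locales fact
  note s = S.bilip_equiv_attractor[OF assms(2-4)] and t = T.bilip_equiv_attractor[OF assms(6-8)]
  show ?thesis
    unfolding Lipschitz_equivalent_iff
    using bilip_equiv_trans[OF s bilip_equiv_trans[OF _ bilip_equiv_sym[OF t]]]
      bilip_equiv_trans[OF bilip_equiv_sym[OF s] bilip_equiv_trans[OF _ t]] by auto
qed

section \<open>Subfamilies given by a semigroup\<close>

lemma sub_alphabet: "alphabet A r \<Longrightarrow> A' \<subseteq> A \<Longrightarrow> alphabet A' r"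
  unfolding alphabet_def using finite_subset[of A' A] by blast

text \<open>What the symbolic argument has to know about a restricted family. Without the guard, an
  empty A' would require 1 \<in> G, because of the empty word.\<close>

definition saturated :: "real set \<Rightarrow> 'a set \<Rightarrow> ('a \<Rightarrow> real) \<Rightarrow> 'a set \<Rightarrow> bool" where
  "saturated G A r A' \<longleftrightarrow> A' \<subseteq> A
    \<and> (A' \<noteq> {} \<longrightarrow> (\<forall>I\<in>lists A'. \<exists>K\<in>lists A'. weight r (I @ K) \<in> G))
    \<and> (\<forall>u\<in>lists A. weight r u \<in> G \<longrightarrow> u \<in> lists A')"

context sim_bij
begin

lemma stable_wordE:
  assumes G: "\<forall>a\<in>G. \<forall>b\<in>G. a * b \<in> G" and sat: "saturated G A r A'" "saturated G B t B'" and ne: "A' \<noteq> {}"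
  obtains I where "stable A r B t f L A' B' I"
proof -
  have "\<exists>I\<in>lists A. \<forall>K\<in>lists A'. \<exists>u\<in>lists B'. J (I @ K) = J I @ u"
  proof (rule stable_word)
    show "A' \<subseteq> A" using sat(1) by (simp add: saturated_def)
    show "a * b \<in> G" if "a \<in> G" "b \<in> G" for a b using G that by simp
    show "\<exists>K\<in>lists A'. weight r (I @ K) \<in> G" if "I \<in> lists A'" for I
      using sat(1) ne that unfolding saturated_def by blast
    show "u \<in> lists B'" if "u \<in> lists B" "weight t u \<in> G" for u
      using sat(2) that unfolding saturated_def by blast
  qed
  then obtain I where "I \<in> lists A" "\<forall>K\<in>lists A'. \<exists>u\<in>lists B'. J (I @ K) = J I @ u" by auto
  then have "stable A r B t f L A' B' I"
    using sat by unfold_locales (auto simp: saturated_def)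
  then show ?thesis by (rule that)
qed

lemma restricted_nonempty:
  assumes "\<forall>a\<in>G. \<forall>b\<in>G. a * b \<in> G" "saturated G A r A'" "saturated G B t B'" "A' \<noteq> {}"
  shows "B' \<noteq> {}"
proof -
  obtain I where "stable A r B t f L A' B' I" by (rule stable_wordE[OF assms(1-4)])
  then interpret stable A r B t f L A' B' I .
  obtain a where "a \<in> A'" using assms(4) by blast
  then have "F (sconst a) \<in> streams B'" by (intro F_in sconst_streams)
  then show ?thesis by (auto simp: streams_empty)
qed

text \<open>The conditions place s between the dimension of B' and that of A'. The stable word leads
  from A' to B', whereas the equivalence runs from B' to A', as a limit of blown-up
  inverses.\<close>

lemma restricted_equiv_aux:
  assumes "\<forall>a\<in>G. \<forall>b\<in>G. a * b \<in> G" "saturated G A r A'" "saturated G B t B'" "A' \<noteq> {}" "B' \<noteq> {}"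
    and s: "0 \<le> s" "1 \<le> (\<Sum>i\<in>A'. r i powr s)" "(\<Sum>j\<in>B'. t j powr s) \<le> 1"
  shows "bilip_equiv (streams B') (sdist t) (streams A') (sdist r)"
proof -
  obtain I where "stable A r B t f L A' B' I" by (rule stable_wordE[OF assms(1-4)])
  then interpret stable A r B t f L A' B' I .
  define P where "P = (\<lambda>n G. (\<forall>y\<in>streams B. G y \<in> streams A)
    \<and> (\<forall>y\<in>streams B. \<forall>z\<in>streams B. sdist t y z \<le> L * L * sdist r (G y) (G z) \<and> sdist r (G y) (G z) \<le> L * L * sdist t y z)
    \<and> (\<forall>y\<in>streams B'. \<forall>x\<in>streams A'. L * L * sdist r (G y) x < 1 \<longrightarrow> (\<exists>z\<in>streams B'. G z = x))
    \<and> (\<forall>y\<in>streams B'. \<exists>z\<in>streams B'. stake n z = stake n y \<and> G z \<in> streams A'))"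
  have "\<exists>G. P n G" for n
    using blowup[OF s, of n] by (simp only: P_def)
  then obtain G where "\<And>n. P n (G n)" by metis
  then have G: "\<And>n. (\<forall>y\<in>streams B. G n y \<in> streams A)"
    "\<And>n. (\<forall>y\<in>streams B. \<forall>z\<in>streams B. sdist t y z \<le> L * L * sdist r (G n y) (G n z) \<and> sdist r (G n y) (G n z) \<le> L * L * sdist t y z)"
    "\<And>n. (\<forall>y\<in>streams B'. \<forall>x\<in>streams A'. L * L * sdist r (G n y) x < 1 \<longrightarrow> (\<exists>z\<in>streams B'. G n z = x))"
    "\<And>n. (\<forall>y\<in>streams B'. \<exists>z\<in>streams B'. stake n z = stake n y \<and> G n z \<in> streams A')"
    by (simp_all add: P_def)
  show ?thesis
    by (rule bilip_equiv_limit[OF A.alphabet_axioms B.alphabet_axioms A'_sub B'_sub assms(5), of "L * L" G])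
       (use G L_ge_1 mult_mono[of 1 L 1 L] in auto)
qed

end

lemma restricted_equiv:
  assumes f: "sim_bij A r B t f L" and G: "\<forall>a\<in>G. \<forall>b\<in>G. a * b \<in> G"
    and sat: "saturated G A r A'" "saturated G B t B'" and ne: "A' \<noteq> {}" "B' \<noteq> {}"
  shows "bilip_equiv (streams A') (sdist r) (streams B') (sdist t)"
proof -
  interpret sim_bij A r B t f L by fact
  interpret inv: sim_bij B t A r "inv_into (streams A) f" L by (rule inverse)
  have sub: "A' \<subseteq> A" "B' \<subseteq> B" using sat by (auto simp: saturated_def)
  obtain a where a: "0 \<le> a" "(\<Sum>i\<in>A'. r i powr a) = 1"
    using dimension_exists[OF sub_alphabet[OF A.alphabet_axioms sub(1)] ne(1)] by blast
  obtain b where b: "0 \<le> b" "(\<Sum>i\<in>B'. t i powr b) = 1"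
    using dimension_exists[OF sub_alphabet[OF B.alphabet_axioms sub(2)] ne(2)] by blast
  show ?thesis
  \<comment> \<open>The side of larger dimension has to be the source, so f is replaced by its
    inverse if that side is B'. The smaller exponent serves as s: one sum is 1 there and the other
    at least 1.\<close>
  proof (cases "b \<le> a")
    case True
    have "(\<Sum>i\<in>A'. r i powr a) \<le> (\<Sum>i\<in>A'. r i powr b)"
    proof (rule sum_mono)
      fix i assume "i \<in> A'"
      then have "i \<in> A" using sub(1) by blast
      then show "r i powr a \<le> r i powr b"
        using powr_mono'[OF True, of "r i"] A.ratio_pos[of i] A.ratio_less_1[of i] by simp
    qed
    then show ?thesis
      using bilip_equiv_sym[OF restricted_equiv_aux[OF G sat ne b(1)]] a b by simp
  next
    case False
    then have ab: "a \<le> b" by simp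
    have "(\<Sum>i\<in>B'. t i powr b) \<le> (\<Sum>i\<in>B'. t i powr a)"
    proof (rule sum_mono)
      fix i assume "i \<in> B'"
      then have "i \<in> B" using sub(2) by blast
      then show "t i powr b \<le> t i powr a"
        using powr_mono'[OF ab, of "t i"] B.ratio_pos[of i] B.ratio_less_1[of i] by simp
    qed
    then show ?thesis
      using inv.restricted_equiv_aux[OF G sat(2,1) ne(2,1) a(1)] a b by simp
  qed
qed

section \<open>One-letter alphabets\<close>

lemma streams_singleton_iff:
  "(\<forall>x\<in>streams A. \<forall>y\<in>streams A. x = y) \<longleftrightarrow> (\<forall>a\<in>A. \<forall>b\<in>A. a = b)"
proof
  assume l: "\<forall>x\<in>streams A. \<forall>y\<in>streams A. x = y"
  show "\<forall>a\<in>A. \<forall>b\<in>A. a = b"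
  proof (intro ballI)
    fix a b assume "a \<in> A" "b \<in> A"
    then have "sconst a = sconst b" by (intro l[rule_format] sconst_streams)
    from arg_cong[OF this, of sset] have "{a} = {b}" by (simp only: sset_sconst)
    then show "a = b" by simp
  qed
next
  assume r: "\<forall>a\<in>A. \<forall>b\<in>A. a = b"
  show "\<forall>x\<in>streams A. \<forall>y\<in>streams A. x = y"
  proof (intro ballI)
    fix x y assume "x \<in> streams A" "y \<in> streams A"
    then have "x !! n = y !! n" for n by (rule r[rule_format, OF snth_in snth_in])
    then have "stake n x = stake n y" for n by (simp add: stake_eq_iff)
    then show "x = y" by (subst stream_eq_iff) (rule allI)
  qed
qed

lemma is_singleton_iff: "is_singleton A \<longleftrightarrow> A \<noteq> {} \<and> (\<forall>a\<in>A. \<forall>b\<in>A. a = b)"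
proof
  assume "is_singleton A"
  then show "A \<noteq> {} \<and> (\<forall>a\<in>A. \<forall>b\<in>A. a = b)" by (auto elim: is_singletonE)
next
  assume r: "A \<noteq> {} \<and> (\<forall>a\<in>A. \<forall>b\<in>A. a = b)"
  show "is_singleton A"
    by (rule is_singletonI'[OF conjunct1[OF r]]) (rule conjunct2[OF r, rule_format])
qed

text \<open>Serves the convention on one-element families: a nonempty alphabet has one letter
  exactly when it has one stream, and bijections preserve this.\<close>

lemma bilip_equiv_is_singleton:
  assumes "bilip_equiv (streams A) d (streams B) e" "A \<noteq> {}" "B \<noteq> {}"
  shows "is_singleton A \<longleftrightarrow> is_singleton B"
proof -
  obtain f where f: "bij_betw f (streams A) (streams B)"
    using assms(1) unfolding bilip_equiv_def by blast
  have "(\<forall>x\<in>streams A. \<forall>y\<in>streams A. x = y) \<longleftrightarrow> (\<forall>x\<in>streams B. \<forall>y\<in>streams B. x = y)"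
  proof
    assume "\<forall>x\<in>streams A. \<forall>y\<in>streams A. x = y"
    then have "\<forall>x\<in>f ` streams A. \<forall>y\<in>f ` streams A. x = y" by auto
    then show "\<forall>x\<in>streams B. \<forall>y\<in>streams B. x = y" using f by (simp only: bij_betw_def)
  next
    assume r: "\<forall>x\<in>streams B. \<forall>y\<in>streams B. x = y"
    show "\<forall>x\<in>streams A. \<forall>y\<in>streams A. x = y"
    proof (intro ballI)
      fix x y assume xy: "x \<in> streams A" "y \<in> streams A"
      then have "f x = f y" using r bij_betwE[OF f] by auto
      then show "x = y" using bij_betw_imp_inj_on[OF f] xy by (auto dest: inj_onD)
    qed
  qed
  then show ?thesis using assms(2,3) by (simp add: is_singleton_iff streams_singleton_iff)
qed

section \<open>Words with weight in the semigroup\<close>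

context ifs
begin

lemma sgp_iff: "a \<in> sgp S \<longleftrightarrow> (\<exists>w\<in>lists S. w \<noteq> [] \<and> a = weight ratio w)"
proof
  assume "a \<in> sgp S"
  then show "\<exists>w\<in>lists S. w \<noteq> [] \<and> a = weight ratio w"
    unfolding sgp_def
  proof induct
    case (generator a)
    then obtain f where "f \<in> S" "a = ratio f" by auto
    then show ?case by (intro bexI[of _ "[f]"]) auto
  next
    case (mult a b)
    then obtain v w where "v \<in> lists S" "w \<in> lists S" "v \<noteq> []" "w \<noteq> []" "a = weight ratio v" "b = weight ratio w"
      by (elim bexE conjE) (rule that)
    then show ?case by (intro bexI[of _ "v @ w"]) auto
  qed
next
  assume "\<exists>w\<in>lists S. w \<noteq> [] \<and> a = weight ratio w"
  then obtain w where "w \<in> lists S" "w \<noteq> []" "a = weight ratio w"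
    by (elim bexE conjE) (rule that)
  moreover have "weight ratio w \<in> generated_semigroup (ratio ` S)" if "w \<in> lists S" "w \<noteq> []" for w
    using that
  proof (induct w)
    case (Cons f w)
    have f: "ratio f \<in> generated_semigroup (ratio ` S)"
      using Cons by (intro generated_semigroup.generator) auto
    show ?case
    proof (cases "w = []")
      case False
      then show ?thesis using Cons generated_semigroup.mult[OF f] by auto
    qed (use f in simp)
  qed simp
  ultimately show "a \<in> sgp S" by (simp add: sgp_def)
qed

lemma restrict_IFS_sub: "restrict_IFS S G \<subseteq> S"
  by (auto simp: restrict_IFS_def)

lemma restrict_IFS_iff: "f \<in> restrict_IFS S G \<longleftrightarrow> f \<in> S \<and> (\<exists>w\<in>lists S. w \<noteq> [] \<and> weight ratio (f # w) \<in> G)"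
proof -
  have "(\<lambda>a. ratio f * a) ` sgp S \<inter> G \<noteq> {} \<longleftrightarrow> (\<exists>a. a \<in> sgp S \<and> ratio f * a \<in> G)" by auto
  also have "\<dots> \<longleftrightarrow> (\<exists>w\<in>lists S. w \<noteq> [] \<and> weight ratio (f # w) \<in> G)"
    unfolding sgp_iff weight_simps by metis
  finally show ?thesis unfolding restrict_IFS_def by simp
qed

text \<open>Any letter of u can be moved to the front without changing the weight. Doubling u keeps
  the weight in G and ensures that letters remain behind it, as the generated semigroup contains no
  empty product.\<close>

lemma word_in_restrict_IFS:
  assumes G: "\<forall>a\<in>G. \<forall>b\<in>G. a * b \<in> G" and u: "u \<in> lists S" "weight ratio u \<in> G"
  shows "u \<in> lists (restrict_IFS S G)"
  unfolding lists_eq_set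
proof (intro CollectI subsetI)
  fix f assume f: "f \<in> set u"
  then obtain v w where vw: "u = v @ f # w" by (metis split_list)
  have "weight ratio u * weight ratio u \<in> G" using G u(2) by blast
  also have "weight ratio u * weight ratio u = weight ratio (f # (v @ w @ u))"
    by (simp add: vw mult_ac)
  finally show "f \<in> restrict_IFS S G"
    using u(1) vw unfolding restrict_IFS_iff by (intro conjI bexI[of _ "v @ w @ u"]) auto
qed

text \<open>Each letter f of I has a companion word w with \<open>f # w\<close> of weight in G.
  Weights commute, so the companions can all be collected at the end.\<close>

lemma extend_to_semigroup:
  assumes G: "\<forall>a\<in>G. \<forall>b\<in>G. a * b \<in> G" and ne: "restrict_IFS S G \<noteq> {}"
    and I: "I \<in> lists (restrict_IFS S G)"
  shows "\<exists>K\<in>lists (restrict_IFS S G). weight ratio (I @ K) \<in> G"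
  using I
proof (induct I)
  case Nil
  obtain f where "f \<in> restrict_IFS S G" using ne by auto
  then obtain w where w: "f \<in> S" "w \<in> lists S" "weight ratio (f # w) \<in> G"
    unfolding restrict_IFS_iff by auto
  then have "f # w \<in> lists (restrict_IFS S G)"
    using word_in_restrict_IFS[OF G, of "f # w"] by simp
  then show ?case using w(3) by (intro bexI[of _ "f # w"]) simp_all
next
  case (Cons f I)
  then have f: "f \<in> restrict_IFS S G" and "\<exists>K\<in>lists (restrict_IFS S G). weight ratio (I @ K) \<in> G" by simp_all
  then obtain K where K: "K \<in> lists (restrict_IFS S G)" "weight ratio (I @ K) \<in> G" by auto
  obtain w where w: "f \<in> S" "w \<in> lists S" "weight ratio (f # w) \<in> G"
    using f unfolding restrict_IFS_iff by auto
  have "weight ratio (f # w) * weight ratio (I @ K) \<in> G" using G w(3) K(2) by blast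
  also have "weight ratio (f # w) * weight ratio (I @ K) = weight ratio ((f # I) @ (K @ w))"
    by (simp add: mult_ac)
  finally have "weight ratio ((f # I) @ (K @ w)) \<in> G" .
  moreover have "w \<in> lists (restrict_IFS S G)"
    using word_in_restrict_IFS[OF G, of "f # w"] w by simp
  ultimately show ?case using K(1) by (intro bexI[of _ "K @ w"]) simp_all
qed

lemma saturated_restrict_IFS:
  assumes "\<forall>a\<in>G. \<forall>b\<in>G. a * b \<in> G"
  shows "saturated G S ratio (restrict_IFS S G)"
  unfolding saturated_def
proof (intro conjI impI ballI)
  show "\<exists>K\<in>lists (restrict_IFS S G). weight ratio (I @ K) \<in> G"
    if "restrict_IFS S G \<noteq> {}" "I \<in> lists (restrict_IFS S G)" for I
    by (rule extend_to_semigroup[OF assms that])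
  show "u \<in> lists (restrict_IFS S G)" if "u \<in> lists S" "weight ratio u \<in> G" for u
    by (rule word_in_restrict_IFS[OF assms that])
qed (rule restrict_IFS_sub)

lemma restrict_IFS_unit_interval: "restrict_IFS S {0<..<1} = S"
proof
  show "S \<subseteq> restrict_IFS S {0<..<1}"
  proof
    fix f assume f: "f \<in> S"
    then have "weight ratio (f # [f]) < 1" "0 < weight ratio (f # [f])"
      using weight_less_1[of "f # [f]"] weight_pos[of "f # [f]"] by auto
    then show "f \<in> restrict_IFS S {0<..<1}"
      unfolding restrict_IFS_iff using f by (intro conjI bexI[of _ "[f]"]) auto
  qed
qed (rule restrict_IFS_sub)

end

theorem theorem2p3:
  fixes S :: "('a::euclidean_space \<Rightarrow> 'a) set"
    and T :: "('b::euclidean_space \<Rightarrow> 'b) set"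
  assumes "IFS S" and "card S \<ge> 2" and "strong_separation S"
    and "IFS T" and "card T \<ge> 2" and "strong_separation T"
  shows "S \<simeq> T \<longleftrightarrow>
    (\<forall>G. subsemigroup_unit_interval G \<longrightarrow> restrict_IFS S G \<simeq> restrict_IFS T G)"
proof
  interpret S: ifs S by unfold_locales fact
  interpret T: ifs T by unfold_locales fact
  {
    \<comment> \<open>One instance is enough: G = (0,1) leaves both families unchanged.\<close>
    assume "\<forall>G. subsemigroup_unit_interval G \<longrightarrow> restrict_IFS S G \<simeq> restrict_IFS T G"
    moreover have "subsemigroup_unit_interval {0<..<1}"
      unfolding subsemigroup_unit_interval_def using mult_strict_mono[of _ 1 _ "1::real"] by auto
    ultimately have "restrict_IFS S {0<..<1} \<simeq> restrict_IFS T {0<..<1}" by blast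
    then show "S \<simeq> T" by (simp only: S.restrict_IFS_unit_interval T.restrict_IFS_unit_interval)
  }
  assume equiv: "S \<simeq> T"
  have ne: "S \<noteq> {}" "T \<noteq> {}" "\<not> is_singleton S" "\<not> is_singleton T"
    using assms(2,5) by (auto simp: is_singleton_def)
  then have "bilip_equiv (streams S) (sdist ratio) (streams T) (sdist ratio)"
    using equiv Lipschitz_equivalent_attractors[OF assms(1,3) subset_refl _ assms(4,6) subset_refl]
    unfolding IFS_equiv_def by simp
  then obtain f L where f: "sim_bij S ratio T ratio f L"
    unfolding bilip_equiv_def using assms(2,5) S.alphabet_axioms T.alphabet_axioms
    by (auto simp: sim_bij_def sim_bij_axioms_def)
  interpret f: sim_bij S ratio T ratio f L by (rule f)
  interpret inv: sim_bij T ratio S ratio "inv_into (streams S) f" L by (rule f.inverse)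
  show "\<forall>G. subsemigroup_unit_interval G \<longrightarrow> restrict_IFS S G \<simeq> restrict_IFS T G"
  proof (intro allI impI)
    fix G assume "subsemigroup_unit_interval G"
    then have G: "\<forall>a\<in>G. \<forall>b\<in>G. a * b \<in> G" by (simp add: subsemigroup_unit_interval_def)
    let ?S = "restrict_IFS S G" and ?T = "restrict_IFS T G"
    note sub = S.restrict_IFS_sub[of G] T.restrict_IFS_sub[of G]
    note sat = S.saturated_restrict_IFS[OF G] T.saturated_restrict_IFS[OF G]
    \<comment> \<open>The stable word of f gives one implication, that of its inverse the
      other.\<close>
    have "?S \<noteq> {} \<longleftrightarrow> ?T \<noteq> {}"
      using f.restricted_nonempty[OF G sat] inv.restricted_nonempty[OF G sat(2,1)] by (rule iffI)
    moreover have "?S \<simeq> ?T" if ne: "?S \<noteq> {}" "?T \<noteq> {}"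
    proof -
      have eq: "bilip_equiv (streams ?S) (sdist ratio) (streams ?T) (sdist ratio)"
        by (rule restricted_equiv[OF f G sat ne])
      then have "Lipschitz_equivalent (attractor ?S) (attractor ?T)"
        using Lipschitz_equivalent_attractors[OF assms(1,3) sub(1) ne(1) assms(4,6) sub(2) ne(2)] by simp
      then show ?thesis
        using ne bilip_equiv_is_singleton[OF eq ne] by (simp add: IFS_equiv_def)
    qed
    ultimately show "?S \<simeq> ?T" by (cases "?S = {}") (simp_all add: IFS_equiv_def)
  qed
qed

end
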